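(* Let $0\le\alpha<1$, let $P_\bullet$ be the size-biased presentation of limit frequencies of a Gibbs$(\alpha)$ partition, and let $X_1,X_2,\ldots$ be a random sample from $P_\bullet$. Let $n\ge1$, let $K_n$ be the number of distinct values among $X_1,\ldots,X_n$, and let $N^{X\uparrow}_{\bullet:n}$ be the value-ordered frequencies of $X_1,\ldots,X_n$. Then, conditionally given $K_n$, the event $X_{n+1}\notin\{X_1,\ldots,X_n\}$ of a new value at time $n+1$ is independent of $N^{X\uparrow}_{\bullet:n}$. In other words, for each composition $(n_1,\ldots,n_k)$ of $n$ the conditional probability $$\mathbb{P}\bigl(X_{n+1}\notin\{X_1,\ldots,X_n\}\,\big|\,N^{X\uparrow}_{\bullet:n}=(n_1,\ldots,n_k)\bigr)$$ depends only on $n$ and $k$ and does not depend otherwise on $(n_1,\ldots,n_k)$.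
   Context: Gibbs$(\alpha)$ partition: an exchangeable random partition of $\mathbb{N}=\{1,2,\ldots\}$ is a sequence $(\Pi_n)$ of random partitions of $[n]=\{1,\ldots,n\}$, with $\Pi_m$ the restriction of $\Pi_n$ to $[m]$ for $m<n$, such that for each $n$ and each partition $\{C_1,\ldots,C_k\}$ of $[n]$, $\mathbb{P}(\Pi_n=\{C_1,\ldots,C_k\})=p(\#C_1,\ldots,\#C_k)$ for some symmetric function $p$ (the EPPF). It is a Gibbs$(\alpha)$ partition if $p(n_1,\ldots,n_k)=V_{k:n}\prod_{i=1}^k(1-\alpha)_{n_i-1}$ with $n=\sum_i n_i$ and $(x)_m=\Gamma(x+m)/\Gamma(x)$, for some positive weights $V_{k:n}$, $1\le k\le n$, satisfying $V_{k:n}=(n-k\alpha)V_{k:n+1}+V_{k+1:n+1}$ for all $1\le k\le n$. The size-biased presentation of its limit frequencies is $P_\bullet=(P_1,P_2,\ldots)$ where $P_j$ is the almost sure limit as $n\to\infty$ of $1/n$ times the size of the $j$th cluster of $\Pi_n$ in order of appearance (order of least elements). It is assumed that $P_j>0$ for all $j$ and $\sum_jP_j=1$ almost surely. A random sample from $P_\bullet$ is a sequence which, conditionally given $P_\bullet$, is i.i.d. with $\mathbb{P}(X_i=j\mid P_\bullet)=P_j$, $j\ge1$. A composition of $n$ is a finite sequence of strictly positive integers with sum $n$. The value-ordered frequencies $N^{X\uparrow}_{\bullet:n}$ form the composition of $n$ that lists, in increasing order of the distinct values occurring among $X_1,\ldots,X_n$, the numbers of times these values occur among $X_1,\ldots,X_n$.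 *)

theory Defs
  imports "HOL-Probability.Probability"
begin

text \<open>All indices (elements of partitioned sets, clusters, frequencies, sample times and sample
  values) start at 1, and what a sequence does at index 0 is irrelevant.\<close>

definition is_composition :: "nat \<Rightarrow> nat list \<Rightarrow> bool" where
  "is_composition n ns \<longleftrightarrow> (\<forall>m\<in>set ns. 0 < m) \<and> sum_list ns = n"

definition random_partition :: "'a measure \<Rightarrow> (nat \<Rightarrow> 'a \<Rightarrow> nat set set) \<Rightarrow> bool" where
  "random_partition M R \<longleftrightarrow>
     (\<forall>n\<ge>1. R n \<in> measurable M (count_space {\<C>. partition_on {1..n} \<C>})) \<and>
     (\<forall>m n. 1 \<le> m \<and> m < n \<longrightarrow>
        (\<forall>\<omega>\<in>space M. R m \<omega> = {C \<inter> {1..m} | C. C \<in> R n \<omega>} - {{}}))"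

text \<open>A distinct list of blocks enumerates the partition in an arbitrary order.\<close>

definition has_eppf :: "'a measure \<Rightarrow> (nat \<Rightarrow> 'a \<Rightarrow> nat set set) \<Rightarrow> (nat list \<Rightarrow> real) \<Rightarrow> bool" where
  "has_eppf M R p \<longleftrightarrow>
     (\<forall>n\<ge>1. \<forall>ms ns. is_composition n ms \<and> mset ms = mset ns \<longrightarrow> p ms = p ns) \<and>
     (\<forall>n\<ge>1. \<forall>Cs. distinct Cs \<and> partition_on {1..n} (set Cs) \<longrightarrow>
        measure M {\<omega>\<in>space M. R n \<omega> = set Cs} = p (map card Cs))"

definition gibbs_weights :: "real \<Rightarrow> (nat \<Rightarrow> nat \<Rightarrow> real) \<Rightarrow> bool" where
  "gibbs_weights \<alpha> V \<longleftrightarrow>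
     (\<forall>k n. 1 \<le> k \<and> k \<le> n \<longrightarrow>
        0 < V k n \<and>
        V k n = (real n - real k * \<alpha>) * V k (n + 1) + V (k + 1) (n + 1))"

text \<open>\<open>pochhammer (1 - \<alpha>) m\<close> is \<open>\<Gamma>(1 - \<alpha> + m) / \<Gamma>(1 - \<alpha>)\<close>, by \<open>pochhammer_Gamma\<close>, as
  \<open>\<alpha> < 1\<close> throughout.\<close>

definition gibbs_partition :: "'a measure \<Rightarrow> real \<Rightarrow> (nat \<Rightarrow> 'a \<Rightarrow> nat set set) \<Rightarrow> bool" where
  "gibbs_partition M \<alpha> R \<longleftrightarrow>
     random_partition M R \<and>
     (\<exists>p V. has_eppf M R p \<and> gibbs_weights \<alpha> V \<and>
        (\<forall>n\<ge>1. \<forall>ns. is_composition n ns \<longrightarrow>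
           p ns = V (length ns) n * (\<Prod>m\<leftarrow>ns. pochhammer (1 - \<alpha>) (m - 1))))"

text \<open>The \<open>j\<close>th block in order of least elements, or the empty set if there are fewer
  than \<open>j\<close> blocks.\<close>

definition nth_cluster :: "nat set set \<Rightarrow> nat \<Rightarrow> nat set" where
  "nth_cluster \<C> j = \<Union>{C \<in> \<C>. card {D \<in> \<C>. Min D \<le> Min C} = j}"

definition size_biased_limit_frequencies ::
    "'a measure \<Rightarrow> (nat \<Rightarrow> 'a \<Rightarrow> nat set set) \<Rightarrow> (nat \<Rightarrow> 'a \<Rightarrow> real) \<Rightarrow> bool" where
  "size_biased_limit_frequencies M R P \<longleftrightarrow>
     (\<forall>j\<ge>1. P j \<in> borel_measurable M \<and>
        (AE \<omega> in M. (\<lambda>n. real (card (nth_cluster (R n \<omega>) j)) / real n) \<longlonglongrightarrow> P j \<omega>))"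

definition generated_algebra :: "'a measure \<Rightarrow> (nat \<Rightarrow> 'a \<Rightarrow> real) \<Rightarrow> 'a measure" where
  "generated_algebra M P =
     sigma (space M) {P j -` B \<inter> space M | j B. 1 \<le> j \<and> B \<in> sets borel}"

definition cond_probability :: "'a measure \<Rightarrow> 'a measure \<Rightarrow> 'a set \<Rightarrow> 'a \<Rightarrow> real" where
  "cond_probability M F A = real_cond_exp M F (indicator A)"

definition cond_indep_vars ::
    "'a measure \<Rightarrow> 'a measure \<Rightarrow> 'b measure \<Rightarrow> ('i \<Rightarrow> 'a \<Rightarrow> 'b) \<Rightarrow> 'i set \<Rightarrow> bool" where
  "cond_indep_vars M F N X I \<longleftrightarrow>
     (\<forall>i\<in>I. X i \<in> measurable M N) \<and>
     (\<forall>J B. finite J \<and> J \<noteq> {} \<and> J \<subseteq> I \<and> (\<forall>i\<in>J. B i \<in> sets N) \<longrightarrow>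
        (AE \<omega> in M. cond_probability M F {\<omega>\<in>space M. \<forall>i\<in>J. X i \<omega> \<in> B i} \<omega>
           = (\<Prod>i\<in>J. cond_probability M F {\<omega>\<in>space M. X i \<omega> \<in> B i} \<omega>)))"

text \<open>That the \<open>X i\<close> are identically distributed given \<open>P\<close> is part of the second clause.\<close>

definition random_sample ::
    "'a measure \<Rightarrow> (nat \<Rightarrow> 'a \<Rightarrow> real) \<Rightarrow> (nat \<Rightarrow> 'a \<Rightarrow> nat) \<Rightarrow> bool" where
  "random_sample M P X \<longleftrightarrow>
     cond_indep_vars M (generated_algebra M P) (count_space {1..}) X {1..} \<and>
     (\<forall>i\<ge>1. \<forall>j\<ge>1. AE \<omega> in M.
        cond_probability M (generated_algebra M P) {\<omega>\<in>space M. X i \<omega> = j} \<omega> = P j \<omega>)"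

definition num_distinct :: "nat \<Rightarrow> (nat \<Rightarrow> nat) \<Rightarrow> nat" where
  "num_distinct n x = card (x ` {1..n})"

definition value_ordered_freqs :: "nat \<Rightarrow> (nat \<Rightarrow> nat) \<Rightarrow> nat list" where
  "value_ordered_freqs n x =
     map (\<lambda>v. card {i \<in> {1..n}. x i = v}) (sorted_list_of_set (x ` {1..n}))"

definition new_value :: "nat \<Rightarrow> (nat \<Rightarrow> nat) \<Rightarrow> bool" where
  "new_value n x \<longleftrightarrow> x (n + 1) \<notin> x ` {1..n}"

end

theory Submission
  imports Defs
begin

text \<open>Group the samples with value-ordered frequencies \<open>(n\<^sub>1, \<dots>, n\<^sub>k)\<close> by their pattern, that is, by which
  of the sample times share a value and how these values are ordered. All patterns with the same
  \<open>(n\<^sub>1, \<dots>, n\<^sub>k)\<close> have the same probability, the expectation of the sum of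
  \<open>P\<^bsub>j(1)\<^esub>^n\<^sub>1 \<cdots> P\<^bsub>j(k)\<^esub>^n\<^sub>k\<close> over all \<open>1 \<le> j(1) < \<dots> < j(k)\<close>. The core of the proof
  (\<open>expectation_order_sum\<close>) is that this expectation factorizes as \<open>V k n * c (n\<^sub>1, \<dots>, n\<^sub>k)\<close>, where \<open>c\<close>
  depends on \<open>\<alpha>\<close> but not on the weights \<open>V\<close>.

  Granted this, a pattern is continued by an old value exactly if one of the \<open>n\<^sub>r\<close> grows by one. By
  \<open>sum_order_coeff_increment\<close> the coefficients \<open>c\<close> of these \<open>k\<close> continuations add up to
  \<open>(n - k * \<alpha>) * c (n\<^sub>1, \<dots>, n\<^sub>k)\<close>, so the Gibbs recursion leaves
  \<open>V (k + 1) (n + 1) * c (n\<^sub>1, \<dots>, n\<^sub>k)\<close> for the continuation by a new value. The conditional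
  probability of a new value is therefore \<open>V (k + 1) (n + 1) / V k n\<close>: both the coefficient \<open>c\<close> and the
  number of patterns cancel.

  The factorization is proved along the labels (in order of appearance) of the clusters that contain
  \<open>1, 2, \<dots>\<close>. On the event that the first \<open>m\<close> labels form a given word, the moments of the
  frequencies of the clusters already seen are again given by the Gibbs formula, as \<open>P j\<close> is a limit
  of relative counts (\<open>Q_prod_moment\<close>). A sum over increasing indices beyond the clusters already seen is
  treated by adding one label at a time, up to a horizon (\<open>stopped_moment\<close>): either the label is
  old, or the cluster that it opens is the first index of the sum or is skipped. What the horizon
  cuts off is described by weights \<open>remainder_weight\<close> that obey a damped Gibbs recursion, and they
  tend to \<open>0\<close>: for the single exponent \<open>1\<close> because the mass of the unseen clusters is one minus the mass of the seen ones, and in general by comparison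
  with that case.\<close>


section \<open>Gibbs weights and coefficients of ordered compositions\<close>

definition block_weight :: "real \<Rightarrow> nat multiset \<Rightarrow> real" where
  "block_weight \<alpha> A = (\<Prod>i\<in>set_mset A. pochhammer (1 - \<alpha>) (count A i - 1))"

text \<open>The probability of a partition whose blocks are named by natural numbers, the block of name \<open>i\<close>
  having \<open>count A i\<close> elements.\<close>

definition gibbs_prob :: "real \<Rightarrow> (nat \<Rightarrow> nat \<Rightarrow> real) \<Rightarrow> nat multiset \<Rightarrow> real" where
  "gibbs_prob \<alpha> V A = V (card (set_mset A)) (size A) * block_weight \<alpha> A"

lemma block_weight_pos: "\<alpha> < 1 \<Longrightarrow> 0 < block_weight \<alpha> A"
  unfolding block_weight_def by (intro prod_pos ballI pochhammer_pos) auto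

lemma block_weight_add_old:
  assumes "i \<in># A"
  shows "block_weight \<alpha> (add_mset i A) = (real (count A i) - \<alpha>) * block_weight \<alpha> A"
proof -
  have c: "count A i = Suc (count A i - 1)" using assms by (simp add: count_greater_zero_iff)
  have "block_weight \<alpha> (add_mset i A) = pochhammer (1 - \<alpha>) (count A i) *
     (\<Prod>j\<in>set_mset A - {i}. pochhammer (1 - \<alpha>) (count A j - 1))"
    unfolding block_weight_def using assms
    by (subst prod.remove[of _ i]) (auto intro!: prod.cong simp: insert_absorb)
  also have "pochhammer (1 - \<alpha>) (count A i) =
      pochhammer (1 - \<alpha>) (count A i - 1) * (1 - \<alpha> + real (count A i - 1))"
    by (subst c) (simp add: pochhammer_rec')
  also have "1 - \<alpha> + real (count A i - 1) = real (count A i) - \<alpha>"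
    by (subst (2) c) simp
  finally show ?thesis unfolding block_weight_def
    by (subst (2) prod.remove[of _ i]) (use assms in auto)
qed

lemma block_weight_add_new:
  assumes "i \<notin># A"
  shows "block_weight \<alpha> (A + replicate_mset (Suc u) i) = pochhammer (1 - \<alpha>) u * block_weight \<alpha> A"
proof -
  have "set_mset (A + replicate_mset (Suc u) i) = insert i (set_mset A)" by auto
  moreover have "count A i = 0" using assms by (simp add: not_in_iff)
  moreover have "(\<Prod>j\<in>set_mset A. pochhammer (1 - \<alpha>) (count (A + replicate_mset (Suc u) i) j - 1))
     = (\<Prod>j\<in>set_mset A. pochhammer (1 - \<alpha>) (count A j - 1))"
    by (rule prod.cong) (use assms in auto)
  ultimately show ?thesis unfolding block_weight_def using assms by simp
qed

lemma sum_count_minus: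
  "(\<Sum>i\<in>set_mset A. real (count A i) - \<alpha>) = real (size A) - real (card (set_mset A)) * \<alpha>"
  by (simp add: sum_subtractf size_multiset_overloaded_eq)

lemma gibbs_prob_add_old:
  assumes "i \<in># A"
  shows "gibbs_prob \<alpha> V (add_mset i A) =
     V (card (set_mset A)) (size A + 1) * (real (count A i) - \<alpha>) * block_weight \<alpha> A"
  using block_weight_add_old[OF assms] assms by (simp add: gibbs_prob_def insert_absorb)

lemma gibbs_prob_add_new:
  assumes "i \<notin># A"
  shows "gibbs_prob \<alpha> V (add_mset i A) =
     V (card (set_mset A) + 1) (size A + 1) * block_weight \<alpha> A"
  using block_weight_add_new[OF assms, of \<alpha> 0] assms by (simp add: gibbs_prob_def)

lemma card_set_mset_le_size: "card (set_mset A) \<le> size A"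
proof -
  have "(\<Sum>i\<in>set_mset A. 1) \<le> (\<Sum>i\<in>set_mset A. count A i)"
    by (intro sum_mono) (simp add: Suc_leI)
  then show ?thesis by (simp add: size_multiset_overloaded_eq)
qed

lemma gibbs_weights_rec:
  assumes "gibbs_weights \<alpha> V" "1 \<le> k" "k \<le> n"
  shows "V k n = (real n - real k * \<alpha>) * V k (n + 1) + V (k + 1) (n + 1)"
  using assms unfolding gibbs_weights_def by blast

text \<open>The Gibbs recursion, read as additivity: the next element joins one of the old blocks or opens
  the block \<open>z\<close>. The old blocks contribute the factor \<open>n - k * \<alpha>\<close> by \<open>sum_count_minus\<close>.\<close>

lemma gibbs_prob_consistent:
  assumes "gibbs_weights \<alpha> V" "A \<noteq> {#}" "z \<notin># A"
  shows "(\<Sum>i\<in>insert z (set_mset A). gibbs_prob \<alpha> V (add_mset i A)) = gibbs_prob \<alpha> V A"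
proof -
  define K where "K = card (set_mset A)"
  have K: "1 \<le> K" "K \<le> size A" using assms(2) card_set_mset_le_size[of A]
    by (auto simp: K_def Suc_le_eq card_gt_0_iff)
  have "(\<Sum>i\<in>set_mset A. gibbs_prob \<alpha> V (add_mset i A)) =
     (\<Sum>i\<in>set_mset A. real (count A i) - \<alpha>) * (V K (size A + 1) * block_weight \<alpha> A)"
    unfolding sum_distrib_right
    by (rule sum.cong) (auto simp: gibbs_prob_add_old K_def)
  then have "(\<Sum>i\<in>insert z (set_mset A). gibbs_prob \<alpha> V (add_mset i A)) =
     ((real (size A) - real K * \<alpha>) * V K (size A + 1) + V (K + 1) (size A + 1)) * block_weight \<alpha> A"
    using assms(3) by (simp add: sum_count_minus gibbs_prob_add_new K_def algebra_simps)
  also have "\<dots> = V K (size A) * block_weight \<alpha> A"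
    using gibbs_weights_rec[OF assms(1) K] by simp
  finally show ?thesis by (simp add: gibbs_prob_def K_def)
qed

text \<open>The factor of the moment of an increasing sum that is free of the Gibbs weights. Its denominators
  \<open>u\<^sub>i + \<dots> + u\<^sub>l - (l - i + 1) * \<alpha>\<close> come from the order: they are the total discounted sizes of the
  blocks from the \<open>i\<close>th on.\<close>

fun order_coeff :: "real \<Rightarrow> nat list \<Rightarrow> real" where
  "order_coeff \<alpha> [] = 1"
| "order_coeff \<alpha> (u # us) = pochhammer (1 - \<alpha>) u
     / (real (sum_list (u # us)) - real (length (u # us)) * \<alpha>) * order_coeff \<alpha> us"

lemma sum_list_ge_length:
  "(\<forall>u\<in>set us. 0 < u) \<Longrightarrow> length us \<le> sum_list us" for us :: "nat list"
  by (induction us) auto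

lemma discounted_sum_ge:
  assumes "\<forall>u\<in>set us. 0 < u" "us \<noteq> []" "\<alpha> < 1" "0 \<le> \<alpha>"
  shows "1 - \<alpha> \<le> real (sum_list us) - real (length us) * \<alpha>"
proof -
  have "1 - \<alpha> \<le> real (length us) * (1 - \<alpha>)"
    using assms mult_right_mono[of 1 "real (length us)" "1 - \<alpha>"]
    by (cases us) auto
  also have "\<dots> \<le> real (sum_list us) - real (length us) * \<alpha>"
    using sum_list_ge_length[OF assms(1)] by (simp add: algebra_simps)
  finally show ?thesis .
qed

lemma order_coeff_pos:
  assumes "\<forall>u\<in>set us. 0 < u" "0 \<le> \<alpha>" "\<alpha> < 1"
  shows "0 < order_coeff \<alpha> us"
  using assms
proof (induction us)
  case (Cons u us)
  then show ?case using discounted_sum_ge[of "u # us" \<alpha>]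
    by (auto intro!: mult_pos_pos divide_pos_pos pochhammer_pos)
qed simp

lemma order_coeff_Cons:
  assumes "\<forall>u\<in>set (u # us). 0 < u" "0 \<le> \<alpha>" "\<alpha> < 1"
  shows "pochhammer (1 - \<alpha>) u * order_coeff \<alpha> us =
    (real (sum_list (u # us)) - real (length (u # us)) * \<alpha>) * order_coeff \<alpha> (u # us)"
  using discounted_sum_ge[OF assms(1) _ assms(3,2)] assms(3) by simp

lemma sum_list_update_Suc:
  "r < length us \<Longrightarrow> sum_list (us[r := Suc (us ! r)]) = Suc (sum_list us)" for us :: "nat list"
  by (simp add: sum_list_update elem_le_sum_list)

text \<open>Raising \<open>u\<^sub>r\<close> by one multiplies \<open>order_coeff\<close> by \<open>1 - \<alpha> + u\<^sub>r\<close> and replaces the tail sums \<open>s\<^sub>i\<close> in the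
  denominators by \<open>s\<^sub>i + 1\<close> for \<open>i \<le> r\<close>. The sum over \<open>r\<close> telescopes from the tail: if the factors of
  the tail add up to its discounted size \<open>s\<^sub>2\<close>, then those of the whole list add up to
  \<open>s\<^sub>1 / (s\<^sub>1 + 1) * (1 - \<alpha> + u\<^sub>1 + s\<^sub>2)\<close>, which is \<open>s\<^sub>1\<close>.\<close>

lemma sum_order_coeff_increment:
  assumes "\<forall>u\<in>set us. 0 < u" "0 \<le> \<alpha>" "\<alpha> < 1"
  shows "(\<Sum>r<length us. order_coeff \<alpha> (us[r := Suc (us ! r)])) =
     (real (sum_list us) - real (length us) * \<alpha>) * order_coeff \<alpha> us"
  using assms
proof (induction us)
  case (Cons u us)
  define s where "s = real (sum_list (u # us)) - real (length (u # us)) * \<alpha>"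
  define p where "p = pochhammer (1 - \<alpha>) u"
  have s: "0 < s" using discounted_sum_ge[of "u # us" \<alpha>] Cons.prems by (auto simp: s_def)
  have IH: "(\<Sum>r<length us. order_coeff \<alpha> (us[r := Suc (us ! r)])) =
     (s - (real u - \<alpha>)) * order_coeff \<alpha> us"
    using Cons by (simp add: s_def algebra_simps)
  have first: "order_coeff \<alpha> (Suc u # us) = p * (1 - \<alpha> + real u) / (s + 1) * order_coeff \<alpha> us"
    by (simp add: s_def p_def pochhammer_rec' algebra_simps)
  have rest: "order_coeff \<alpha> (u # us[r := Suc (us ! r)]) =
      p / (s + 1) * order_coeff \<alpha> (us[r := Suc (us ! r)])" if "r < length us" for r
    using sum_list_update_Suc[OF that] by (simp add: s_def p_def algebra_simps)
  have "(\<Sum>r<length (u # us). order_coeff \<alpha> ((u # us)[r := Suc ((u # us) ! r)])) =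
     order_coeff \<alpha> (Suc u # us) + (\<Sum>r<length us. order_coeff \<alpha> (u # us[r := Suc (us ! r)]))"
    by (simp only: length_Cons sum.lessThan_Suc_shift) simp
  also have "(\<Sum>r<length us. order_coeff \<alpha> (u # us[r := Suc (us ! r)])) =
     p / (s + 1) * ((s - (real u - \<alpha>)) * order_coeff \<alpha> us)"
    unfolding IH[symmetric] sum_distrib_left by (rule sum.cong) (auto simp: rest simp del: order_coeff.simps)
  also have "order_coeff \<alpha> (Suc u # us) + \<dots> = p * order_coeff \<alpha> us"
  proof -
    have "p * (1 - \<alpha> + real u) * order_coeff \<alpha> us + p * ((s - (real u - \<alpha>)) * order_coeff \<alpha> us)
        = p * order_coeff \<alpha> us * (s + 1)"
      by (simp add: algebra_simps)
    then show ?thesis unfolding first using s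
      by (simp add: add_divide_distrib[symmetric] nonzero_divide_eq_eq)
  qed
  also have "\<dots> = s * order_coeff \<alpha> (u # us)"
    using s by (simp add: p_def s_def)
  finally show ?case by (simp add: s_def)
qed simp

section \<open>Words of cluster labels\<close>

text \<open>Words are kept with the newest letter first, so that a word is extended by \<open>#\<close>. A word describes a
  partition with blocks labelled in order of appearance exactly if no label is skipped.\<close>

fun restricted_growth :: "nat list \<Rightarrow> bool" where
  "restricted_growth [] = True"
| "restricted_growth (l # y) = (restricted_growth y \<and> 1 \<le> l \<and> l \<le> Suc (card (set y)))"

lemma restricted_growth_set:
  "restricted_growth y \<Longrightarrow> set y = {1..card (set y)}"
proof (induction y)
  case (Cons l y)
  then have y: "set y = {1..card (set y)}" by simp
  show ?case
  proof (cases "l \<in> set y")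
    case True
    then show ?thesis using y by (simp add: insert_absorb)
  next
    case False
    then have "l = Suc (card (set y))" using Cons.prems y
      by (metis atLeastAtMost_iff le_SucE restricted_growth.simps(2))
    then show ?thesis using y False
      by (metis atLeastAtMostSuc_conv card_insert_disjoint finite_set le_add1 list.simps(15) plus_1_eq_Suc)
  qed
qed simp

lemma restricted_growth_new:
  assumes "restricted_growth y"
  shows "Suc (card (set y)) \<notin> set y"
  by (subst restricted_growth_set[OF assms]) simp

lemma restricted_growth_Cons:
  assumes "restricted_growth y" "l \<in> insert (Suc (card (set y))) (set y)"
  shows "restricted_growth (l # y)"
proof -
  have "l \<in> insert (Suc (card (set y))) {1..card (set y)}"
    using assms(2) restricted_growth_set[OF assms(1)] by metis
  then show ?thesis using assms(1) by auto
qed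

primrec word :: "(nat \<Rightarrow> 'a \<Rightarrow> nat) \<Rightarrow> nat \<Rightarrow> 'a \<Rightarrow> nat list" where
  "word Y 0 \<omega> = []"
| "word Y (Suc m) \<omega> = Y (Suc m) \<omega> # word Y m \<omega>"

lemma length_word [simp]: "length (word Y m \<omega>) = m"
  by (induction m) auto

lemma count_list_mset: "count_list xs r = count (mset xs) r"
  by (induction xs) auto

text \<open>What the moment computation uses of a Gibbs partition: \<open>Y x\<close> is the label of the cluster of \<open>x\<close>, and
  \<open>Q\<close> is a version of the limit frequencies that is a subprobability everywhere, so that the sums
  below are bounded random variables without exceptional sets. The index \<open>0\<close> carries no mass, which
  lets sums range over all natural numbers.\<close>

locale gibbs_frequencies = prob_space M for M :: "'a measure" +
  fixes \<alpha> :: real and V :: "nat \<Rightarrow> nat \<Rightarrow> real"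
    and Y :: "nat \<Rightarrow> 'a \<Rightarrow> nat" and Q :: "nat \<Rightarrow> 'a \<Rightarrow> real"
  assumes alpha: "0 \<le> \<alpha>" "\<alpha> < 1"
    and weights: "gibbs_weights \<alpha> V"
    and word_measurable [measurable]: "word Y m \<in> measurable M (count_space UNIV)"
    and word_growth: "\<omega> \<in> space M \<Longrightarrow> restricted_growth (word Y m \<omega>)"
    and word_prob: "restricted_growth y \<Longrightarrow> y \<noteq> [] \<Longrightarrow>
      prob {\<omega>\<in>space M. word Y (length y) \<omega> = y} = gibbs_prob \<alpha> V (mset y)"
    and Q_measurable [measurable]: "Q j \<in> borel_measurable M"
    and Q_nonneg: "0 \<le> Q j \<omega>"
    and Q_summable: "summable (\<lambda>j. Q j \<omega>)"
    and Q_sum_le: "(\<Sum>j. Q j \<omega>) \<le> 1"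
    and Q_0: "Q 0 \<omega> = 0"
    and Q_sum: "AE \<omega> in M. (\<Sum>j. Q j \<omega>) = 1"
    and Q_pos: "AE \<omega> in M. \<forall>j\<ge>1. 0 < Q j \<omega>"
    and Q_lim: "AE \<omega> in M. \<forall>j\<ge>1. (\<lambda>n. real (count_list (word Y n \<omega>) j) / real n) \<longlonglongrightarrow> Q j \<omega>"
begin

definition bounded_rv :: "('a \<Rightarrow> real) \<Rightarrow> bool" where
  "bounded_rv g \<longleftrightarrow> g \<in> borel_measurable M \<and> (\<exists>B. \<forall>\<omega>. \<bar>g \<omega>\<bar> \<le> B)"

definition on_word :: "nat list \<Rightarrow> ('a \<Rightarrow> real) \<Rightarrow> real" where
  "on_word y g = expectation (\<lambda>\<omega>. indicator {\<omega>\<in>space M. word Y (length y) \<omega> = y} \<omega> * g \<omega>)"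

definition Q_prod :: "nat multiset \<Rightarrow> 'a \<Rightarrow> real" where
  "Q_prod W \<omega> = (\<Prod>j\<in>#W. Q j \<omega>)"

lemma bounded_rvI:
  "g \<in> borel_measurable M \<Longrightarrow> (\<And>\<omega>. 0 \<le> g \<omega>) \<Longrightarrow> (\<And>\<omega>. g \<omega> \<le> B) \<Longrightarrow> bounded_rv g"
  unfolding bounded_rv_def by (auto intro!: exI[of _ B])

lemma bounded_rv_measurable [measurable_dest]: "bounded_rv g \<Longrightarrow> g \<in> borel_measurable M"
  by (simp add: bounded_rv_def)

lemma bounded_rv_mult: "bounded_rv f \<Longrightarrow> bounded_rv g \<Longrightarrow> bounded_rv (\<lambda>\<omega>. f \<omega> * g \<omega>)"
proof -
  assume fg: "bounded_rv f" "bounded_rv g"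
  then obtain A B where "\<And>\<omega>. \<bar>f \<omega>\<bar> \<le> A" "\<And>\<omega>. \<bar>g \<omega>\<bar> \<le> B" by (auto simp: bounded_rv_def)
  then have "\<bar>f \<omega> * g \<omega>\<bar> \<le> A * B" for \<omega>
    unfolding abs_mult by (intro mult_mono) (auto intro: order_trans[OF abs_ge_zero])
  then show ?thesis using fg by (auto simp: bounded_rv_def)
qed

lemma bounded_rv_add: "bounded_rv f \<Longrightarrow> bounded_rv g \<Longrightarrow> bounded_rv (\<lambda>\<omega>. f \<omega> + g \<omega>)"
proof -
  assume fg: "bounded_rv f" "bounded_rv g"
  then obtain A B where "\<And>\<omega>. \<bar>f \<omega>\<bar> \<le> A" "\<And>\<omega>. \<bar>g \<omega>\<bar> \<le> B" by (auto simp: bounded_rv_def)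
  then have "\<bar>f \<omega> + g \<omega>\<bar> \<le> A + B" for \<omega>
    by (meson abs_triangle_ineq add_mono order_trans)
  then show ?thesis using fg by (auto simp: bounded_rv_def)
qed

lemma bounded_rv_const: "bounded_rv (\<lambda>_. c)"
  by (auto simp: bounded_rv_def)

lemma bounded_rv_diff: "bounded_rv f \<Longrightarrow> bounded_rv g \<Longrightarrow> bounded_rv (\<lambda>\<omega>. f \<omega> - g \<omega>)"
  using bounded_rv_add[of f "\<lambda>\<omega>. - 1 * g \<omega>"] bounded_rv_mult[OF bounded_rv_const[of "-1"], of g]
  by simp

lemma bounded_rv_sum: "(\<And>i. i \<in> I \<Longrightarrow> bounded_rv (f i)) \<Longrightarrow> bounded_rv (\<lambda>\<omega>. \<Sum>i\<in>I. f i \<omega>)"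
  by (induction I rule: infinite_finite_induct) (auto intro: bounded_rv_add bounded_rv_const)

lemma Q_le_1: "Q j \<omega> \<le> 1"
  using sum_le_suminf[OF Q_summable[of \<omega>], of "{j}"] Q_sum_le[of \<omega>] Q_nonneg by simp

lemma Q_prod_bounds: "0 \<le> Q_prod W \<omega>" "Q_prod W \<omega> \<le> 1"
proof -
  have "0 \<le> Q_prod W \<omega> \<and> Q_prod W \<omega> \<le> 1"
    by (induction W) (auto simp: Q_prod_def Q_nonneg Q_le_1 intro!: mult_le_one)
  then show "0 \<le> Q_prod W \<omega>" "Q_prod W \<omega> \<le> 1" by auto
qed

lemma Q_prod_measurable [measurable]: "Q_prod W \<in> borel_measurable M"
proof (induction W)
  case empty
  then show ?case by (simp add: Q_prod_def[abs_def])
next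
  case (add j W)
  then have "(\<lambda>\<omega>. Q j \<omega> * Q_prod W \<omega>) \<in> borel_measurable M" by simp
  then show ?case by (simp add: Q_prod_def[abs_def])
qed

lemma bounded_rv_Q_prod: "bounded_rv (Q_prod W)"
  by (rule bounded_rvI[OF Q_prod_measurable Q_prod_bounds])

lemma bounded_rv_Q: "bounded_rv (Q j)"
  by (rule bounded_rvI[OF Q_measurable Q_nonneg Q_le_1])

lemma integrable_on_word:
  assumes "bounded_rv g"
  shows "integrable M (\<lambda>\<omega>. indicator {\<omega>\<in>space M. word Y m \<omega> = y} \<omega> * g \<omega> :: real)"
proof -
  obtain B where B: "\<And>\<omega>. \<bar>g \<omega>\<bar> \<le> B" using assms by (auto simp: bounded_rv_def)
  show ?thesis
  proof (rule integrable_const_bound[of _ B])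
    show "AE \<omega> in M. norm (indicator {\<omega>\<in>space M. word Y m \<omega> = y} \<omega> * g \<omega>) \<le> B"
      using B order_trans[OF abs_ge_zero B] by (auto simp: indicator_def)
    show "(\<lambda>\<omega>. indicator {\<omega>\<in>space M. word Y m \<omega> = y} \<omega> * g \<omega>) \<in> borel_measurable M"
      using bounded_rv_measurable[OF assms] by measurable
  qed
qed

lemma on_word_add:
  "bounded_rv f \<Longrightarrow> bounded_rv g \<Longrightarrow> on_word y (\<lambda>\<omega>. f \<omega> + g \<omega>) = on_word y f + on_word y g"
  unfolding on_word_def distrib_left by (intro Bochner_Integration.integral_add integrable_on_word)

lemma on_word_diff:
  "bounded_rv f \<Longrightarrow> bounded_rv g \<Longrightarrow> on_word y (\<lambda>\<omega>. f \<omega> - g \<omega>) = on_word y f - on_word y g"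
  unfolding on_word_def right_diff_distrib by (intro Bochner_Integration.integral_diff integrable_on_word)

lemma on_word_cmult: "on_word y (\<lambda>\<omega>. c * g \<omega>) = c * on_word y g"
  unfolding on_word_def by (simp add: mult.left_commute)

lemma on_word_sum:
  "(\<And>i. i \<in> I \<Longrightarrow> bounded_rv (f i)) \<Longrightarrow>
    on_word y (\<lambda>\<omega>. \<Sum>i\<in>I. f i \<omega>) = (\<Sum>i\<in>I. on_word y (f i))"
  unfolding on_word_def sum_distrib_left
  by (intro Bochner_Integration.integral_sum integrable_on_word)

lemma on_word_cong:
  assumes "\<And>\<omega>. \<omega> \<in> space M \<Longrightarrow> word Y (length y) \<omega> = y \<Longrightarrow> f \<omega> = g \<omega>"
  shows "on_word y f = on_word y g"
  unfolding on_word_def by (rule Bochner_Integration.integral_cong) (auto simp: indicator_def assms)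

lemma on_word_cong_AE:
  assumes "bounded_rv f" "bounded_rv g"
    and "AE \<omega> in M. word Y (length y) \<omega> = y \<longrightarrow> f \<omega> = g \<omega>"
  shows "on_word y f = on_word y g"
  unfolding on_word_def
  using assms(3) integrable_on_word[OF assms(1)] integrable_on_word[OF assms(2)]
  by (intro integral_cong_AE) (auto simp: indicator_def elim!: eventually_mono)

text \<open>The words one letter longer partition the event of the word \<open>y\<close>.\<close>

lemma on_word_split:
  assumes "restricted_growth y" "bounded_rv g"
  shows "on_word y g = (\<Sum>l\<in>insert (Suc (card (set y))) (set y). on_word (l # y) g)"
proof -
  let ?I = "insert (Suc (card (set y))) (set y)"
  have "on_word y g = expectation (\<lambda>\<omega>. \<Sum>l\<in>?I.
      indicator {\<omega>\<in>space M. word Y (length (l # y)) \<omega> = l # y} \<omega> * g \<omega>)"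
    unfolding on_word_def sum_distrib_right[symmetric]
  proof (intro Bochner_Integration.integral_cong refl arg_cong2[where f="(*)"])
    fix \<omega> assume \<omega>: "\<omega> \<in> space M"
    let ?l = "Y (Suc (length y)) \<omega>"
    have l: "?l \<in> ?I" if "word Y (length y) \<omega> = y"
    proof -
      have "restricted_growth (?l # y)" using word_growth[OF \<omega>, of "Suc (length y)"] that by simp
      then show ?thesis using restricted_growth_set[OF assms(1)] by (auto simp: le_Suc_eq)
    qed
    have "(\<Sum>l\<in>?I. indicator {\<omega>\<in>space M. word Y (length (l # y)) \<omega> = l # y} \<omega>)
       = (\<Sum>l\<in>?I. if l = ?l then indicator {\<omega>\<in>space M. word Y (length y) \<omega> = y} \<omega> else 0 :: real)"
      by (rule sum.cong) (auto simp: indicator_def)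
    also have "\<dots> = indicator {\<omega>\<in>space M. word Y (length y) \<omega> = y} \<omega>"
      using l by (simp add: sum.delta' sum.delta) (auto simp: indicator_def)
    finally show "indicator {\<omega>\<in>space M. word Y (length y) \<omega> = y} \<omega> =
      (\<Sum>l\<in>?I. indicator {\<omega>\<in>space M. word Y (length (l # y)) \<omega> = l # y} \<omega> :: real)" by simp
  qed
  also have "\<dots> = (\<Sum>l\<in>?I. on_word (l # y) g)"
    unfolding on_word_def
    by (intro Bochner_Integration.integral_sum integrable_on_word assms(2))
  finally show ?thesis .
qed

lemma on_word_LIMSEQ:
  assumes "\<And>t. bounded_rv (f t)" "bounded_rv g"
    and "\<And>t \<omega>. \<bar>f t \<omega>\<bar> \<le> B"
    and "AE \<omega> in M. (\<lambda>t. f t \<omega>) \<longlonglongrightarrow> g \<omega>"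
  shows "(\<lambda>t. on_word y (f t)) \<longlonglongrightarrow> on_word y g"
  unfolding on_word_def
proof (rule integral_dominated_convergence[where w="\<lambda>_. B"])
  show "AE \<omega> in M. (\<lambda>t. indicator {\<omega>\<in>space M. word Y (length y) \<omega> = y} \<omega> * f t \<omega>)
      \<longlonglongrightarrow> indicator {\<omega>\<in>space M. word Y (length y) \<omega> = y} \<omega> * g \<omega>"
    using assms(4) by eventually_elim (intro tendsto_intros)
  have B: "0 \<le> B" using assms(3)[of 0 undefined] by simp
  show "AE \<omega> in M. norm (indicator {\<omega>\<in>space M. word Y (length y) \<omega> = y} \<omega> * f t \<omega>) \<le> B" for t
    using assms(3) B by (auto simp: indicator_def)
qed (use integrable_on_word[OF assms(1)] integrable_on_word[OF assms(2)] in auto)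

lemma bounded_rv_count: "bounded_rv (\<lambda>\<omega>. real (count_list (word Y n \<omega>) r))"
proof (rule bounded_rvI)
  show "real (count_list (word Y n \<omega>) r) \<le> real n" for \<omega>
    using count_le_length[of "word Y n \<omega>" r] by simp
qed auto

section \<open>Moments of seen frequencies\<close>

text \<open>Multiplying by \<open>Q r\<close> has the effect of sampling one further element of cluster \<open>r\<close>. For the next
  letter this is the definition of the word event, and by consistency every later letter equals \<open>r\<close> with
  the same weight; so the expected count of \<open>r\<close> grows linearly, with the claimed value as its slope, while
  the count divided by the length tends to \<open>Q r\<close>.\<close>

lemma Q_prod_moment:
  assumes "restricted_growth y" "y \<noteq> []" "set_mset W \<subseteq> set y"
  shows "on_word y (Q_prod W) = gibbs_prob \<alpha> V (mset y + W)"
  using assms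
proof (induction W arbitrary: y)
  case empty
  have "on_word y (Q_prod {#}) = prob {\<omega>\<in>space M. word Y (length y) \<omega> = y}"
    by (simp add: on_word_def Q_prod_def)
  then show ?case using word_prob empty by simp
next
  case (add r W)
  have cons: "(\<Sum>l\<in>insert (Suc (card (set y))) (set y). gibbs_prob \<alpha> V (add_mset l (mset y) + W'))
      = gibbs_prob \<alpha> V (mset y + W')"
    if "restricted_growth y" "y \<noteq> []" "set_mset W' \<subseteq> set y" for y W'
  proof -
    have *: "set_mset (mset y + W') = set y" using that by auto
    have "Suc (card (set y)) \<notin> set y" by (rule restricted_growth_new[OF that(1)])
    then have "Suc (card (set y)) \<notin># mset y + W'" using that(3) by auto
    from gibbs_prob_consistent[OF weights _ this] * that(2) show ?thesis by auto
  qed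
  \<comment> \<open>the slope of the expected count of \<open>r\<close>\<close>
  let ?p = "\<lambda>y. gibbs_prob \<alpha> V (add_mset r (mset y + W))"
  have count: "on_word y (\<lambda>\<omega>. Q_prod W \<omega> * real (count_list (word Y (length y + t) \<omega>) r))
      = real (count_list y r) * gibbs_prob \<alpha> V (mset y + W) + real t * ?p y"
    if "restricted_growth y" "y \<noteq> []" "set_mset (add_mset r W) \<subseteq> set y" for t y
    using that
  proof (induction t arbitrary: y)
    case 0
    have "on_word y (\<lambda>\<omega>. Q_prod W \<omega> * real (count_list (word Y (length y + 0) \<omega>) r))
       = on_word y (\<lambda>\<omega>. real (count_list y r) * Q_prod W \<omega>)"
      by (rule on_word_cong) simp
    then show ?case using add.IH[of y] 0 by (simp add: on_word_cmult)
  next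
    case (Suc t)
    let ?I = "insert (Suc (card (set y))) (set y)"
    have fin: "finite ?I" by simp
    have rI: "r \<in> ?I" using Suc.prems by simp
    have "on_word y (\<lambda>\<omega>. Q_prod W \<omega> * real (count_list (word Y (length y + Suc t) \<omega>) r))
      = (\<Sum>l\<in>?I. on_word (l # y) (\<lambda>\<omega>. Q_prod W \<omega> * real (count_list (word Y (length (l # y) + t) \<omega>) r)))"
      by (subst on_word_split[OF Suc.prems(1) bounded_rv_mult[OF bounded_rv_Q_prod bounded_rv_count]]) simp
    also have "\<dots> = (\<Sum>l\<in>?I. real (count_list (l # y) r) * gibbs_prob \<alpha> V (mset (l # y) + W)
        + real t * ?p (l # y))"
    proof (intro sum.cong refl Suc.IH)
      fix l assume "l \<in> ?I"
      then show "restricted_growth (l # y)" by (rule restricted_growth_Cons[OF Suc.prems(1)])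
    qed (use Suc.prems in auto)
    also have "\<dots> = (\<Sum>l\<in>?I. real (count_list y r) * gibbs_prob \<alpha> V (add_mset l (mset y) + W)
         + (if l = r then gibbs_prob \<alpha> V (add_mset r (mset y) + W) else 0)
         + real t * gibbs_prob \<alpha> V (add_mset l (mset y) + add_mset r W))"
      by (intro sum.cong refl) (simp add: algebra_simps add_mset_commute)
    also have "\<dots> = real (count_list y r) * gibbs_prob \<alpha> V (mset y + W) + ?p y + real t * ?p y"
      unfolding sum.distrib sum_distrib_left[symmetric] sum.delta'[OF fin] sum.delta[OF fin]
      using cons[of y W] cons[of y "add_mset r W"] Suc.prems rI by simp
    finally show ?case by (simp add: algebra_simps)
  qed
  define N where "N = length y"
  let ?f = "\<lambda>t \<omega>. Q_prod W \<omega> * (real (count_list (word Y (N + t) \<omega>) r) / real (N + t))"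
  have N: "0 < N" using add.prems by (simp add: N_def)
  have r: "r \<in> set y" "1 \<le> r" using add.prems restricted_growth_set[of y] by auto
  have frac: "bounded_rv (\<lambda>\<omega>. real (count_list (word Y n \<omega>) r) / real n)" for n
    using bounded_rv_mult[OF bounded_rv_const[of "1 / real n"] bounded_rv_count[of n r]] by simp
  have lim: "(\<lambda>t. on_word y (?f t)) \<longlonglongrightarrow> on_word y (\<lambda>\<omega>. Q_prod W \<omega> * Q r \<omega>)"
  proof (rule on_word_LIMSEQ[where B=1])
    show "AE \<omega> in M. (\<lambda>t. ?f t \<omega>) \<longlonglongrightarrow> Q_prod W \<omega> * Q r \<omega>"
      using Q_lim
    proof eventually_elim
      case (elim \<omega>)
      then have "(\<lambda>n. real (count_list (word Y n \<omega>) r) / real n) \<longlonglongrightarrow> Q r \<omega>" using r by simp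
      from LIMSEQ_ignore_initial_segment[OF this, of N]
      have "(\<lambda>t. real (count_list (word Y (N + t) \<omega>) r) / real (N + t)) \<longlonglongrightarrow> Q r \<omega>"
        by (simp add: add.commute)
      then show ?case by (intro tendsto_intros)
    qed
    show "\<bar>?f t \<omega>\<bar> \<le> 1" for t \<omega>
    proof -
      have "real (count_list (word Y (N + t) \<omega>) r) / real (N + t) \<le> 1"
        using count_le_length[of "word Y (N + t) \<omega>" r] N by (simp add: divide_le_eq)
      then show ?thesis using Q_prod_bounds[of W \<omega>]
        by (simp only: abs_mult abs_of_nonneg zero_le_divide_iff of_nat_0_le_iff mult_le_one simp_thms)
    qed
  qed (intro bounded_rv_mult bounded_rv_Q_prod bounded_rv_Q frac)+
  have eq: "on_word y (?f t) =
      (real (count_list y r) * gibbs_prob \<alpha> V (mset y + W) + real t * ?p y) / real (N + t)" for t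
  proof -
    have "on_word y (?f t) = on_word y (\<lambda>\<omega>. 1 / real (N + t) *
        (Q_prod W \<omega> * real (count_list (word Y (length y + t) \<omega>) r)))"
      by (simp add: N_def)
    then show ?thesis using count[OF add.prems] unfolding on_word_cmult by simp
  qed
  have ces: "(\<lambda>t. (c + real t * d) / real (N + t)) \<longlonglongrightarrow> d" for c d :: real
  proof -
    have "(\<lambda>t. (c - real N * d) / real (N + t) + d) \<longlonglongrightarrow> 0 + d"
      by (intro tendsto_add tendsto_const tendsto_divide_0[where F=sequentially]
        filterlim_at_top_imp_at_infinity filterlim_compose[OF filterlim_real_sequentially]
        filterlim_tendsto_add_at_top[of "\<lambda>_. N"]) (auto intro!: filterlim_subseq simp: strict_mono_def)
    moreover have "(c - real N * d) / real (N + t) + d = (c + real t * d) / real (N + t)" for t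
      using N by (simp add: field_simps)
    ultimately show ?thesis by simp
  qed
  have "on_word y (\<lambda>\<omega>. Q_prod W \<omega> * Q r \<omega>) = ?p y"
    using lim ces unfolding eq by (rule LIMSEQ_unique)
  then show ?case by (simp add: Q_prod_def mult.commute)
qed

end

section \<open>Sums over increasing cluster indices\<close>

text \<open>The sum of \<open>q j\<^sub>1 ^ u\<^sub>1 * \<dots> * q j\<^sub>l ^ u\<^sub>l\<close> over all \<open>K < j\<^sub>1 < \<dots> < j\<^sub>l\<close>, organized by its
  first index.\<close>

fun tail_sum :: "(nat \<Rightarrow> real) \<Rightarrow> nat \<Rightarrow> nat list \<Rightarrow> real" where
  "tail_sum q K [] = 1"
| "tail_sum q K (u # us) = (\<Sum>j. q (Suc K + j) ^ u * tail_sum q (Suc K + j) us)"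

context
  fixes q :: "nat \<Rightarrow> real"
  assumes q_nonneg: "\<And>j. 0 \<le> q j" and q_summable: "summable q" and q_sum: "suminf q \<le> 1"
begin

lemma tail_summable: "summable (\<lambda>j. q (K + j))"
  using summable_ignore_initial_segment[OF q_summable, of K] by (simp add: add.commute)

lemma tail_suminf_le: "(\<Sum>j. q (K + j)) \<le> 1"
proof -
  have "(\<Sum>j. q (K + j)) = suminf q - sum q {..<K}"
    using suminf_minus_initial_segment[OF q_summable, of K] by (simp add: add.commute)
  then show ?thesis using q_sum sum_nonneg[of "{..<K}" q] q_nonneg by simp
qed

lemma q_le_1: "q j \<le> 1"
  using sum_le_suminf[OF q_summable, of "{j}"] q_sum q_nonneg by simp

lemma tail_sum_bounds:
  assumes "\<forall>u\<in>set us. 0 < u"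
  shows "0 \<le> tail_sum q K us \<and> tail_sum q K us \<le> 1"
    and "0 < u \<Longrightarrow> summable (\<lambda>j. q (Suc K + j) ^ u * tail_sum q (Suc K + j) us)"
    and "0 < u \<Longrightarrow> 0 \<le> tail_sum q K (u # us) \<and> tail_sum q K (u # us) \<le> (\<Sum>j. q (Suc K + j))"
proof -
  have *: "summable (\<lambda>j. q (Suc K + j) ^ u * tail_sum q (Suc K + j) us) \<and>
      0 \<le> tail_sum q K (u # us) \<and> tail_sum q K (u # us) \<le> (\<Sum>j. q (Suc K + j))"
    if "0 < u" and b: "\<And>K. 0 \<le> tail_sum q K us \<and> tail_sum q K us \<le> 1" for K u us
  proof -
    have le: "q j ^ u * tail_sum q j us \<le> q j" for j
    proof -
      have "q j ^ u \<le> q j" using power_decreasing[of 1 u "q j"] that(1) q_nonneg q_le_1 by simp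
      then show ?thesis using b[of j] mult_mono[of "q j ^ u" "q j" "tail_sum q j us" 1] q_nonneg by simp
    qed
    have ge: "0 \<le> q j ^ u * tail_sum q j us" for j using b q_nonneg by simp
    have sm: "summable (\<lambda>j. q (Suc K + j) ^ u * tail_sum q (Suc K + j) us)"
      by (rule summable_comparison_test'[OF tail_summable[of "Suc K"]]) (use le ge in \<open>simp add: abs_of_nonneg\<close>)
    then show ?thesis using suminf_nonneg[OF sm ge] suminf_le[OF le sm tail_summable] by simp
  qed
  have bound: "0 \<le> tail_sum q K us \<and> tail_sum q K us \<le> 1" if "\<forall>u\<in>set us. 0 < u" for K us
    using that
  proof (induction us arbitrary: K)
    case (Cons u us)
    then show ?case using *[of u us K] tail_suminf_le[of "Suc K"] by fastforce
  qed simp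
  from bound[OF assms] show "0 \<le> tail_sum q K us \<and> tail_sum q K us \<le> 1" .
  show "0 < u \<Longrightarrow> summable (\<lambda>j. q (Suc K + j) ^ u * tail_sum q (Suc K + j) us)"
    and "0 < u \<Longrightarrow> 0 \<le> tail_sum q K (u # us) \<and> tail_sum q K (u # us) \<le> (\<Sum>j. q (Suc K + j))"
    using *[of u us K] bound[OF assms] by auto
qed

lemma tail_sum_rec:
  assumes "\<forall>u\<in>set us. 0 < u" "0 < u"
  shows "tail_sum q K (u # us) =
    q (Suc K) ^ u * tail_sum q (Suc K) us + tail_sum q (Suc K) (u # us)"
  using suminf_split_head[OF tail_sum_bounds(2)[OF assms, of K]] by simp

lemma tail_sum_tendsto_0:
  assumes "\<forall>u\<in>set us. 0 < u" "0 < u" "filterlim k at_top F"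
  shows "((\<lambda>t. tail_sum q (k t) (u # us)) \<longlongrightarrow> 0) F"
proof (rule tendsto_sandwich[where f="\<lambda>_. 0"])
  have "(\<lambda>K. suminf q - sum q {..<Suc K}) \<longlonglongrightarrow> suminf q - suminf q"
    by (intro tendsto_diff tendsto_const LIMSEQ_Suc summable_LIMSEQ q_summable)
  moreover have "(\<Sum>j. q (Suc K + j)) = suminf q - sum q {..<Suc K}" for K
    using suminf_minus_initial_segment[OF q_summable, of "Suc K"] by (simp add: add.commute)
  ultimately have "(\<lambda>K. \<Sum>j. q (Suc K + j)) \<longlonglongrightarrow> 0" by simp
  then show "((\<lambda>t. \<Sum>j. q (Suc (k t) + j)) \<longlongrightarrow> 0) F"
    using assms(3) by (rule filterlim_compose)
  show "\<forall>\<^sub>F t in F. tail_sum q (k t) (u # us) \<le> (\<Sum>j. q (Suc (k t) + j))"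
    "\<forall>\<^sub>F t in F. 0 \<le> tail_sum q (k t) (u # us)"
    using tail_sum_bounds(3)[OF assms(1,2)] by (simp_all only: eventually_True simp_thms)
qed simp

end

text \<open>The part of the weight \<open>V k n\<close> that is not yet accounted for after \<open>t\<close> further labels. The damping by
  \<open>s\<close>, the discounted size of the exponents still to be placed, is the loss to the event that a newly opened
  cluster becomes the first index of the increasing sum.\<close>

primrec remainder_weight :: "real \<Rightarrow> (nat \<Rightarrow> nat \<Rightarrow> real) \<Rightarrow> real \<Rightarrow> nat \<Rightarrow> nat \<Rightarrow> nat \<Rightarrow> real" where
  "remainder_weight \<alpha> V s 0 k n = V k n"
| "remainder_weight \<alpha> V s (Suc t) k n =
     (real n - real k * \<alpha> - s) * remainder_weight \<alpha> V s t k (n + 1)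
      + remainder_weight \<alpha> V s t (k + 1) (n + 1)"

text \<open>The side condition \<open>0 \<le> n - k * \<alpha> - s\<close> keeps all coefficients of the recursion nonnegative, and it
  passes from \<open>(k, n)\<close> to \<open>(k, n + 1)\<close> and \<open>(k + 1, n + 1)\<close> because \<open>\<alpha> < 1\<close>.\<close>

lemma remainder_weight_antimono:
  assumes "gibbs_weights \<alpha> V" "0 \<le> \<alpha>" "\<alpha> < 1" "s' \<le> s" "0 \<le> real n - real k * \<alpha> - s" "1 \<le> k" "k \<le> n"
  shows "0 \<le> remainder_weight \<alpha> V s t k n \<and> remainder_weight \<alpha> V s t k n \<le> remainder_weight \<alpha> V s' t k n"
  using assms(5-7)
proof (induction t arbitrary: k n)
  case 0
  then have "0 < V k n" using assms(1) unfolding gibbs_weights_def by blast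
  then show ?case by simp
next
  case (Suc t)
  have a: "0 \<le> real (n + 1) - real k * \<alpha> - s" "0 \<le> real (n + 1) - real (k + 1) * \<alpha> - s"
    using Suc.prems(1) assms(3) by (auto simp: algebra_simps)
  note IH1 = Suc.IH[OF a(1)] and IH2 = Suc.IH[OF a(2)]
  have "(real n - real k * \<alpha> - s) * remainder_weight \<alpha> V s t k (n + 1)
      \<le> (real n - real k * \<alpha> - s') * remainder_weight \<alpha> V s' t k (n + 1)"
    using IH1 Suc.prems assms(4) by (intro mult_mono) auto
  then show ?case using IH1 IH2 Suc.prems by simp
qed

lemma set_mset_word_add: "set_mset W \<subseteq> set y \<Longrightarrow> set_mset (mset y + W) = set y"
  by auto

context gibbs_frequencies
begin

definition num_clusters :: "nat \<Rightarrow> 'a \<Rightarrow> nat" where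
  "num_clusters m \<omega> = card (set (word Y m \<omega>))"

definition order_sum :: "nat \<Rightarrow> nat list \<Rightarrow> 'a \<Rightarrow> real" where
  "order_sum K us \<omega> = tail_sum (\<lambda>j. Q j \<omega>) K us"

lemma num_clusters_measurable [measurable]: "num_clusters m \<in> measurable M (count_space UNIV)"
  unfolding num_clusters_def[abs_def] by measurable

lemma order_sum_measurable [measurable]: "order_sum K us \<in> borel_measurable M"
  unfolding order_sum_def[abs_def]
  by (induction us arbitrary: K) auto

lemma order_sum_bounds:
  assumes "\<forall>u\<in>set us. 0 < u"
  shows "0 \<le> order_sum K us \<omega>" "order_sum K us \<omega> \<le> 1"
  using tail_sum_bounds(1)[of "\<lambda>j. Q j \<omega>", OF Q_nonneg Q_summable Q_sum_le assms]
  unfolding order_sum_def by auto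

lemma order_sum_rec:
  assumes "\<forall>u\<in>set (u # us). 0 < u"
  shows "order_sum K (u # us) \<omega> =
    Q (Suc K) \<omega> ^ u * order_sum (Suc K) us \<omega> + order_sum (Suc K) (u # us) \<omega>"
  using tail_sum_rec[of "\<lambda>j. Q j \<omega>", OF Q_nonneg Q_summable Q_sum_le] assms
  unfolding order_sum_def by simp

lemma bounded_rv_order_sum:
  assumes "\<forall>u\<in>set us. 0 < u"
  shows "bounded_rv (order_sum K us)"
  by (rule bounded_rvI[OF order_sum_measurable order_sum_bounds[OF assms]])

lemma bounded_rv_stopped_order_sum:
  assumes "\<forall>u\<in>set us. 0 < u"
  shows "bounded_rv (\<lambda>\<omega>. order_sum (num_clusters m \<omega>) us \<omega>)"
  by (rule bounded_rvI[OF measurable_compose_countable[OF order_sum_measurable num_clusters_measurable]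
      order_sum_bounds[OF assms]])

text \<open>Every frequency is positive, so every label occurs sooner or later, and the labels seen form an
  initial segment.\<close>

lemma num_clusters_at_top:
  "AE \<omega> in M. filterlim (\<lambda>m. num_clusters m \<omega>) at_top sequentially"
  using Q_lim Q_pos AE_space
proof eventually_elim
  case (elim \<omega>)
  show ?case unfolding filterlim_at_top_ge[where c="1::nat"]
  proof (intro allI impI)
    fix Z :: nat assume Z: "1 \<le> Z"
    have "\<forall>\<^sub>F n in sequentially. 0 < real (count_list (word Y n \<omega>) Z) / real n"
      using elim Z by (intro order_tendstoD(1)) auto
    then show "\<forall>\<^sub>F n in sequentially. Z \<le> num_clusters n \<omega>"
    proof eventually_elim
      case (elim n)
      then have "count_list (word Y n \<omega>) Z \<noteq> 0" by (intro notI) simp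
      then have "Z \<in> set (word Y n \<omega>)" by (simp add: count_list_0_iff)
      then show ?case unfolding num_clusters_def
        using restricted_growth_set[OF word_growth[OF \<open>\<omega> \<in> space M\<close>, of n]]
        by (metis atLeastAtMost_iff)
    qed
  qed
qed

lemma stopped_order_sum_tendsto_0:
  assumes "\<forall>u\<in>set us. 0 < u" "us \<noteq> []"
  shows "(\<lambda>t. on_word y (\<lambda>\<omega>. Q_prod W \<omega> * order_sum (num_clusters (m + t) \<omega>) us \<omega>)) \<longlonglongrightarrow> 0"
proof -
  have "(\<lambda>t. on_word y (\<lambda>\<omega>. Q_prod W \<omega> * order_sum (num_clusters (m + t) \<omega>) us \<omega>))
     \<longlonglongrightarrow> on_word y (\<lambda>_. 0)"
  proof (rule on_word_LIMSEQ[where B=1])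
    show "AE \<omega> in M. (\<lambda>t. Q_prod W \<omega> * order_sum (num_clusters (m + t) \<omega>) us \<omega>) \<longlonglongrightarrow> 0"
      using num_clusters_at_top
    proof eventually_elim
      case (elim \<omega>)
      then have "filterlim (\<lambda>t. num_clusters (m + t) \<omega>) at_top sequentially"
        by (rule filterlim_compose) (auto intro!: filterlim_subseq simp: strict_mono_def)
      moreover obtain u us' where us: "us = u # us'" using assms(2) by (cases us) auto
      ultimately have "(\<lambda>t. order_sum (num_clusters (m + t) \<omega>) us \<omega>) \<longlonglongrightarrow> 0"
        unfolding order_sum_def us using assms(1)
        by (intro tail_sum_tendsto_0[OF Q_nonneg Q_summable Q_sum_le]) (auto simp: us)
      then show ?case by (rule tendsto_mult_right_zero)
    qed
    show "\<bar>Q_prod W \<omega> * order_sum (num_clusters (m + t) \<omega>) us \<omega>\<bar> \<le> 1" for t \<omega>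
      using Q_prod_bounds[of W \<omega>] order_sum_bounds[OF assms(1)]
      by (simp add: abs_mult abs_of_nonneg mult_le_one)
  qed (intro bounded_rv_mult bounded_rv_Q_prod bounded_rv_const bounded_rv_stopped_order_sum assms)+
  then show ?thesis by (simp add: on_word_def)
qed

text \<open>The induction hypothesis of the moment computation, for one list of exponents and all words.\<close>

definition order_moment_formula :: "nat list \<Rightarrow> bool" where
  "order_moment_formula us \<longleftrightarrow> (\<forall>y W. restricted_growth y \<longrightarrow> y \<noteq> [] \<longrightarrow> set_mset W \<subseteq> set y \<longrightarrow>
     on_word y (\<lambda>\<omega>. Q_prod W \<omega> * order_sum (card (set y)) us \<omega>) =
       block_weight \<alpha> (mset y + W) * order_coeff \<alpha> us
         * V (card (set y) + length us) (size (mset y + W) + sum_list us))"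

text \<open>The increasing sum is cut off at the clusters that have appeared \<open>t\<close> labels later, and \<open>t\<close> is decreased
  by revealing the next label. An old label only changes the word. A label that opens cluster \<open>K + 1\<close>
  splits the sum: terms starting at \<open>K + 1\<close> reduce to the shorter list \<open>us\<close>, where no cut-off applies, and the
  others are covered by \<open>t - 1\<close>. The coefficient \<open>order_coeff\<close> is such that the first part
  contributes \<open>s\<close> and completes \<open>n - k * \<alpha> - s\<close>, the total of the old labels, to the coefficient of the Gibbs
  recursion.\<close>

lemma stopped_moment:
  assumes pos: "\<forall>u\<in>set (u # us). 0 < u" and IH: "order_moment_formula us"
    and "restricted_growth y" "y \<noteq> []" "set_mset W \<subseteq> set y"
    and s: "s = real (sum_list (u # us)) - real (length (u # us)) * \<alpha>"
  shows "on_word y (\<lambda>\<omega>. Q_prod W \<omega> * (order_sum (card (set y)) (u # us) \<omega>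
      - order_sum (num_clusters (length y + t) \<omega>) (u # us) \<omega>)) =
    block_weight \<alpha> (mset y + W) * order_coeff \<alpha> (u # us) *
     (V (card (set y) + length (u # us)) (size (mset y + W) + sum_list (u # us))
      - remainder_weight \<alpha> V s t (card (set y) + length (u # us)) (size (mset y + W) + sum_list (u # us)))"
  using assms(3-5)
proof (induction t arbitrary: y)
  case 0
  have "on_word y (\<lambda>\<omega>. Q_prod W \<omega> * (order_sum (card (set y)) (u # us) \<omega>
      - order_sum (num_clusters (length y + 0) \<omega>) (u # us) \<omega>)) = on_word y (\<lambda>_. 0)"
    by (rule on_word_cong) (simp add: num_clusters_def)
  then show ?case by (simp add: on_word_def)
next
  case (Suc t)
  define K where "K = card (set y)"
  define A where "A = mset y + W"
  define k where "k = K + length (u # us)"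
  define N where "N = size A + sum_list (u # us)"
  define \<nu> where "\<nu> = remainder_weight \<alpha> V s t"
  define c where "c = order_coeff \<alpha> (u # us)"
  have setA: "set_mset A = set y" unfolding A_def using Suc.prems(3) by (rule set_mset_word_add)
  have new: "Suc K \<notin> set y" unfolding K_def by (rule restricted_growth_new[OF Suc.prems(1)])
  have bdd: "bounded_rv (\<lambda>\<omega>. Q_prod W \<omega> * (order_sum j (u # us) \<omega>
      - order_sum (num_clusters m \<omega>) (u # us) \<omega>))" for m j
    by (intro bounded_rv_mult bounded_rv_Q_prod bounded_rv_diff bounded_rv_order_sum
        bounded_rv_stopped_order_sum pos)
  let ?g = "\<lambda>j \<omega>. Q_prod W \<omega> * (order_sum j (u # us) \<omega>
      - order_sum (num_clusters (length y + Suc t) \<omega>) (u # us) \<omega>)"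
  have old: "on_word (l # y) (?g K) =
      (real (count A l) - \<alpha>) * (block_weight \<alpha> A * c * (V k (N + 1) - \<nu> k (N + 1)))"
    if l: "l \<in> set y" for l
  proof -
    have "restricted_growth (l # y)" by (rule restricted_growth_Cons[OF Suc.prems(1)]) (use l in simp)
    from Suc.IH[OF this] Suc.prems(3)
    have "on_word (l # y) (?g K) = block_weight \<alpha> (add_mset l A) * c * (V k (N + 1) - \<nu> k (N + 1))"
      using l by (simp add: insert_absorb K_def A_def k_def N_def \<nu>_def c_def subset_insertI2)
    then show ?thesis using block_weight_add_old[of l A] l setA by simp
  qed
  have fresh: "on_word (Suc K # y) (?g K) = block_weight \<alpha> A * c *
       (s * V k (N + 1) + (V (k + 1) (N + 1) - \<nu> (k + 1) (N + 1)))"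
  proof -
    have rg: "restricted_growth (Suc K # y)"
      by (rule restricted_growth_Cons[OF Suc.prems(1)]) (simp add: K_def)
    have card': "card (set (Suc K # y)) = Suc K" using new by (simp add: K_def)
    let ?W = "W + replicate_mset u (Suc K)"
    have split: "?g K \<omega> = Q_prod ?W \<omega> * order_sum (Suc K) us \<omega> + ?g (Suc K) \<omega>" for \<omega>
    proof -
      have "Q_prod ?W \<omega> = Q_prod W \<omega> * Q (Suc K) \<omega> ^ u" by (simp add: Q_prod_def)
      then show ?thesis by (subst order_sum_rec[OF pos, of K]) (simp add: algebra_simps)
    qed
    have p: "\<forall>u\<in>set us. 0 < u" using pos by simp
    have "on_word (Suc K # y) (?g K) =
        on_word (Suc K # y) (\<lambda>\<omega>. Q_prod ?W \<omega> * order_sum (Suc K) us \<omega>) + on_word (Suc K # y) (?g (Suc K))"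
      unfolding split
      by (rule on_word_add[OF bounded_rv_mult[OF bounded_rv_Q_prod bounded_rv_order_sum[OF p]] bdd])
    also have "on_word (Suc K # y) (\<lambda>\<omega>. Q_prod ?W \<omega> * order_sum (Suc K) us \<omega>)
       = block_weight \<alpha> (A + replicate_mset (Suc u) (Suc K)) * order_coeff \<alpha> us * V k (N + 1)"
    proof -
      have "set_mset ?W \<subseteq> set (Suc K # y)" using Suc.prems(3) by (auto split: if_splits)
      from IH[unfolded order_moment_formula_def, rule_format, OF rg _ this, unfolded card']
      show ?thesis by (simp add: A_def k_def N_def algebra_simps)
    qed
    also have "block_weight \<alpha> (A + replicate_mset (Suc u) (Suc K)) = pochhammer (1 - \<alpha>) u * block_weight \<alpha> A"
      by (rule block_weight_add_new) (use new setA in simp)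
    also have "on_word (Suc K # y) (?g (Suc K)) =
       block_weight \<alpha> (add_mset (Suc K) A) * c * (V (k + 1) (N + 1) - \<nu> (k + 1) (N + 1))"
    proof -
      have "set_mset W \<subseteq> set (Suc K # y)" using Suc.prems(3) by auto
      from Suc.IH[OF rg _ this, unfolded card']
      show ?thesis by (simp add: A_def k_def N_def c_def \<nu>_def)
    qed
    also have "block_weight \<alpha> (add_mset (Suc K) A) = block_weight \<alpha> A"
      using block_weight_add_new[of "Suc K" A \<alpha> 0] new setA by simp
    also have "pochhammer (1 - \<alpha>) u * block_weight \<alpha> A * order_coeff \<alpha> us * V k (N + 1)
        = block_weight \<alpha> A * (pochhammer (1 - \<alpha>) u * order_coeff \<alpha> us) * V k (N + 1)" by simp
    also have "pochhammer (1 - \<alpha>) u * order_coeff \<alpha> us = s * c"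
      unfolding c_def s by (rule order_coeff_Cons[OF pos alpha])
    finally show ?thesis by (simp add: algebra_simps)
  qed
  have regroup: "b * (s * v + (v' - r')) + (a - s) * (b * (v - r)) =
      b * ((a * v + v') - ((a - s) * r + r'))" for a b v v' r r' :: real
    by (simp add: algebra_simps)
  have "on_word y (?g K) = (\<Sum>l\<in>insert (Suc K) (set y). on_word (l # y) (?g K))"
    unfolding K_def by (rule on_word_split[OF Suc.prems(1) bdd])
  also have "\<dots> = on_word (Suc K # y) (?g K) + (\<Sum>l\<in>set_mset A. real (count A l) - \<alpha>)
      * (block_weight \<alpha> A * c * (V k (N + 1) - \<nu> k (N + 1)))"
    using new old setA by (simp add: sum_distrib_right)
  also have "(\<Sum>l\<in>set_mset A. real (count A l) - \<alpha>) = real N - real k * \<alpha> - s"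
    using sum_count_minus[of A \<alpha>] unfolding setA by (simp add: N_def k_def s K_def algebra_simps)
  also have "on_word (Suc K # y) (?g K) + (real N - real k * \<alpha> - s)
      * (block_weight \<alpha> A * c * (V k (N + 1) - \<nu> k (N + 1))) =
     block_weight \<alpha> A * c * (((real N - real k * \<alpha>) * V k (N + 1) + V (k + 1) (N + 1))
       - ((real N - real k * \<alpha> - s) * \<nu> k (N + 1) + \<nu> (k + 1) (N + 1)))"
    unfolding fresh by (rule regroup)
  also have "(real N - real k * \<alpha>) * V k (N + 1) + V (k + 1) (N + 1) = V k N"
  proof -
    have "1 \<le> k" "k \<le> N" using sum_list_ge_length[OF pos] card_set_mset_le_size[of A]
      by (auto simp: k_def N_def K_def setA)
    from gibbs_weights_rec[OF weights this] show ?thesis by simp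
  qed
  finally show ?case by (simp add: K_def A_def k_def N_def c_def \<nu>_def)
qed

end

lemma restricted_growth_upt: "restricted_growth (rev [1..<Suc m])"
proof (induction m)
  case (Suc m)
  have "set (rev [1..<Suc m]) = {1..m}" by auto
  then have "card (set (rev [1..<Suc m])) = m" by simp
  then show ?case using Suc by (simp only: upt_Suc_append rev_append restricted_growth.simps) simp
qed simp

context gibbs_frequencies
begin

lemma on_word_order_sum_limit:
  assumes "\<forall>u\<in>set us. 0 < u" "us \<noteq> []"
  shows "(\<lambda>t. on_word y (\<lambda>\<omega>. Q_prod W \<omega> *
      (order_sum K us \<omega> - order_sum (num_clusters (m + t) \<omega>) us \<omega>)))
    \<longlonglongrightarrow> on_word y (\<lambda>\<omega>. Q_prod W \<omega> * order_sum K us \<omega>)"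
proof -
  have "(\<lambda>t. on_word y (\<lambda>\<omega>. Q_prod W \<omega> * order_sum K us \<omega>)
      - on_word y (\<lambda>\<omega>. Q_prod W \<omega> * order_sum (num_clusters (m + t) \<omega>) us \<omega>))
    \<longlonglongrightarrow> on_word y (\<lambda>\<omega>. Q_prod W \<omega> * order_sum K us \<omega>) - 0"
    by (intro tendsto_diff tendsto_const stopped_order_sum_tendsto_0 assms)
  then show ?thesis
    unfolding right_diff_distrib
    by (subst on_word_diff) (auto intro!: bounded_rv_mult bounded_rv_Q_prod bounded_rv_order_sum
      bounded_rv_stopped_order_sum assms)
qed

section \<open>Expectations of increasing sums\<close>

text \<open>For the single exponent \<open>1\<close> the increasing sum is the mass of the clusters not yet seen.\<close>

lemma order_sum_singleton:
  "AE \<omega> in M. order_sum K [1] \<omega> = 1 - (\<Sum>i\<in>{1..K}. Q i \<omega>)"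
  using Q_sum
proof eventually_elim
  case (elim \<omega>)
  have "(\<Sum>j. Q (Suc K + j) \<omega>) = (\<Sum>j. Q j \<omega>) - (\<Sum>i<Suc K. Q i \<omega>)"
    using suminf_minus_initial_segment[OF Q_summable[of \<omega>], of "Suc K"] by (simp add: add.commute)
  moreover have "(\<Sum>i<Suc K. Q i \<omega>) = (\<Sum>i\<in>{1..K}. Q i \<omega>)"
    by (simp add: lessThan_Suc_atMost sum.atLeast1_atMost_eq sum.atMost_shift Q_0 del: sum.lessThan_Suc)
  ultimately show ?case using elim by (simp add: order_sum_def)
qed

text \<open>The base case that needs no limit: by \<open>order_sum_singleton\<close> the moment is a difference of moments of seen
  frequencies, which consistency identifies as the weight of opening a new cluster.\<close>

lemma unseen_mass_moment:
  assumes "restricted_growth y" "y \<noteq> []" "set_mset W \<subseteq> set y"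
  shows "on_word y (\<lambda>\<omega>. Q_prod W \<omega> * order_sum (card (set y)) [1] \<omega>) =
    V (card (set y) + 1) (size (mset y + W) + 1) * block_weight \<alpha> (mset y + W)"
proof -
  define A where "A = mset y + W"
  have setA: "set_mset A = set y" unfolding A_def using assms(3) by (rule set_mset_word_add)
  have new: "Suc (card (set y)) \<notin># A" using restricted_growth_new[OF assms(1)] setA by simp
  have "on_word y (\<lambda>\<omega>. Q_prod W \<omega> * order_sum (card (set y)) [1] \<omega>) =
      on_word y (\<lambda>\<omega>. Q_prod W \<omega> - (\<Sum>i\<in>set y. Q_prod (add_mset i W) \<omega>))"
  proof (rule on_word_cong_AE)
    show "AE \<omega> in M. word Y (length y) \<omega> = y \<longrightarrow> Q_prod W \<omega> * order_sum (card (set y)) [1] \<omega> =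
      Q_prod W \<omega> - (\<Sum>i\<in>set y. Q_prod (add_mset i W) \<omega>)"
      using order_sum_singleton[of "card (set y)"]
    proof eventually_elim
      case (elim \<omega>)
      have "(\<Sum>i\<in>set y. Q_prod (add_mset i W) \<omega>) = Q_prod W \<omega> * (\<Sum>i\<in>set y. Q i \<omega>)"
        unfolding sum_distrib_left by (rule sum.cong) (simp_all add: Q_prod_def mult.commute)
      also have "(\<Sum>i\<in>set y. Q i \<omega>) = (\<Sum>i\<in>{1..card (set y)}. Q i \<omega>)"
        using restricted_growth_set[OF assms(1)] by simp
      finally show ?case using elim by (simp add: right_diff_distrib)
    qed
  qed (intro bounded_rv_mult bounded_rv_Q_prod bounded_rv_order_sum bounded_rv_diff bounded_rv_sum; simp)+
  also have "\<dots> = on_word y (Q_prod W) - (\<Sum>i\<in>set y. on_word y (Q_prod (add_mset i W)))"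
    by (subst on_word_diff) (auto intro!: bounded_rv_Q_prod bounded_rv_sum simp: on_word_sum bounded_rv_Q_prod)
  also have "\<dots> = gibbs_prob \<alpha> V A - (\<Sum>i\<in>set_mset A. gibbs_prob \<alpha> V (add_mset i A))"
    using assms by (simp add: Q_prod_moment setA) (simp add: A_def)
  also have "gibbs_prob \<alpha> V A =
      (\<Sum>i\<in>insert (Suc (card (set y))) (set_mset A). gibbs_prob \<alpha> V (add_mset i A))"
    by (rule gibbs_prob_consistent[symmetric, OF weights _ new]) (use assms in \<open>simp add: A_def\<close>)
  also have "\<dots> - (\<Sum>i\<in>set_mset A. gibbs_prob \<alpha> V (add_mset i A)) =
      gibbs_prob \<alpha> V (add_mset (Suc (card (set y))) A)"
    using new by simp
  finally show ?thesis using gibbs_prob_add_new[OF new] setA by (simp add: A_def)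
qed

lemma order_moment_formula_Nil: "order_moment_formula []"
  unfolding order_moment_formula_def
proof (intro allI impI)
  fix y W assume y: "restricted_growth y" "y \<noteq> []" "set_mset W \<subseteq> set y"
  show "on_word y (\<lambda>\<omega>. Q_prod W \<omega> * order_sum (card (set y)) [] \<omega>) =
     block_weight \<alpha> (mset y + W) * order_coeff \<alpha> []
     * V (card (set y) + length []) (size (mset y + W) + sum_list [])"
    using Q_prod_moment[OF y] set_mset_word_add[OF y(3)]
    by (simp add: order_sum_def gibbs_prob_def)
qed

text \<open>For the exponent \<open>1\<close> the full moment is known from \<open>unseen_mass_moment\<close>, whereas \<open>stopped_moment\<close>
  expresses the cut-off moments, which converge to it, through the remainder weights. Hence the latter vanish in the limit.\<close>

lemma remainder_weight_tendsto_0_critical: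
  assumes "2 \<le> k" "k \<le> n"
  shows "(\<lambda>t. remainder_weight \<alpha> V (1 - \<alpha>) t k n) \<longlonglongrightarrow> 0"
proof -
  \<comment> \<open>any word and multiset with \<open>k - 1\<close> clusters and \<open>n - 1\<close> elements would do\<close>
  define y where "y = rev [1..<Suc (k - 1)]"
  define W where "W = replicate_mset (n - k) (1::nat)"
  define A where "A = mset y + W"
  have y: "restricted_growth y" "y \<noteq> []" "set_mset W \<subseteq> set y"
    unfolding y_def using assms restricted_growth_upt[of "k - 1"]
    by (simp_all only:) (auto simp: W_def split: if_splits)
  have card: "card (set y) + 1 = k" "size A + 1 = n"
    using assms by (auto simp: y_def W_def A_def)
  have b: "0 < block_weight \<alpha> A" by (rule block_weight_pos[OF alpha(2)])
  have "(\<lambda>t. block_weight \<alpha> A * (V k n - remainder_weight \<alpha> V (1 - \<alpha>) t k n))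
      \<longlonglongrightarrow> V k n * block_weight \<alpha> A"
  proof -
    have p: "\<forall>u\<in>set [1::nat]. 0 < u" by simp
    have c: "order_coeff \<alpha> [1] = 1" using alpha by simp
    show ?thesis
      using on_word_order_sum_limit[OF p, of y W "card (set y)" "length y"]
      unfolding unseen_mass_moment[OF y] stopped_moment[OF p order_moment_formula_Nil y refl] c
      using card by (simp add: A_def)
  qed
  from tendsto_diff[OF tendsto_const[of "V k n"] tendsto_divide[OF this tendsto_const[of "block_weight \<alpha> A"]]]
  show ?thesis using b by simp
qed

text \<open>Every nonempty list of exponents has discounted size at least \<open>1 - \<alpha>\<close>, the value for the single exponent
  \<open>1\<close>, and the remainder weights decrease in \<open>s\<close>.\<close>

lemma remainder_weight_tendsto_0:
  assumes "2 \<le> k" "k \<le> n" "1 - \<alpha> \<le> s" "0 \<le> real n - real k * \<alpha> - s"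
  shows "(\<lambda>t. remainder_weight \<alpha> V s t k n) \<longlonglongrightarrow> 0"
proof (rule tendsto_sandwich[OF _ _ tendsto_const remainder_weight_tendsto_0_critical[OF assms(1,2)]])
  have *: "0 \<le> remainder_weight \<alpha> V s t k n
      \<and> remainder_weight \<alpha> V s t k n \<le> remainder_weight \<alpha> V (1 - \<alpha>) t k n" for t
    by (rule remainder_weight_antimono[OF weights alpha assms(3,4) _ assms(2)]) (use assms(1) in simp)
  show "\<forall>\<^sub>F t in sequentially. 0 \<le> remainder_weight \<alpha> V s t k n"
    and "\<forall>\<^sub>F t in sequentially. remainder_weight \<alpha> V s t k n \<le> remainder_weight \<alpha> V (1 - \<alpha>) t k n"
    using * by simp_all
qed

lemma order_moment:
  assumes "\<forall>u\<in>set us. 0 < u"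
  shows "order_moment_formula us"
  using assms
proof (induction us)
  case Nil
  show ?case by (rule order_moment_formula_Nil)
next
  case (Cons u us)
  then have IH: "order_moment_formula us" by simp
  show ?case
    unfolding order_moment_formula_def
  proof (intro allI impI)
    fix y W assume y: "restricted_growth y" "y \<noteq> []" "set_mset W \<subseteq> set y"
    define A where "A = mset y + W"
    define s where "s = real (sum_list (u # us)) - real (length (u # us)) * \<alpha>"
    define k where "k = card (set y) + length (u # us)"
    define n where "n = size A + sum_list (u # us)"
    have setA: "set_mset A = set y" unfolding A_def using y(3) by (rule set_mset_word_add)
    have K: "card (set y) \<le> size A" "0 < card (set y)"
      using card_set_mset_le_size[of A] y(2) by (auto simp: setA card_gt_0_iff)
    have 1: "2 \<le> k" "k \<le> n"
      using K sum_list_ge_length[OF Cons.prems] by (auto simp: k_def n_def)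
    have 2: "1 - \<alpha> \<le> s"
      unfolding s_def using discounted_sum_ge[OF Cons.prems _ alpha(2,1)] by simp
    have "real (card (set y)) * \<alpha> \<le> real (card (set y)) * 1"
      by (rule mult_left_mono) (use alpha in auto)
    then have 3: "0 \<le> real n - real k * \<alpha> - s"
      using K(1) by (simp add: n_def k_def s_def algebra_simps)
    have "(\<lambda>t. block_weight \<alpha> A * order_coeff \<alpha> (u # us) * (V k n - remainder_weight \<alpha> V s t k n))
       \<longlonglongrightarrow> block_weight \<alpha> A * order_coeff \<alpha> (u # us) * (V k n - 0)"
      by (intro tendsto_intros remainder_weight_tendsto_0 1 2 3)
    moreover have "(\<lambda>t. block_weight \<alpha> A * order_coeff \<alpha> (u # us) * (V k n - remainder_weight \<alpha> V s t k n))
       \<longlonglongrightarrow> on_word y (\<lambda>\<omega>. Q_prod W \<omega> * order_sum (card (set y)) (u # us) \<omega>)"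
      using on_word_order_sum_limit[OF Cons.prems, of y W "card (set y)" "length y"]
      unfolding stopped_moment[OF Cons.prems IH y refl] A_def k_def n_def s_def by blast
    ultimately show "on_word y (\<lambda>\<omega>. Q_prod W \<omega> * order_sum (card (set y)) (u # us) \<omega>) =
       block_weight \<alpha> (mset y + W) * order_coeff \<alpha> (u # us)
       * V (card (set y) + length (u # us)) (size (mset y + W) + sum_list (u # us))"
      using LIMSEQ_unique unfolding A_def k_def n_def by fastforce
  qed
qed

text \<open>The first label is always \<open>1\<close>, so one step of the recursion by first index reduces the claim to moments
  on the word \<open>[1]\<close>; the Gibbs recursion then removes that step again. The empty word is avoided since the
  Gibbs formula says nothing about \<open>n = 0\<close>.\<close>

lemma expectation_order_sum:
  assumes "\<forall>u\<in>set us. 0 < u" "us \<noteq> []"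
  shows "expectation (order_sum 0 us) = V (length us) (sum_list us) * order_coeff \<alpha> us"
proof -
  obtain u us' where us: "us = u # us'" using assms(2) by (cases us) auto
  define s where "s = real (sum_list (u # us')) - real (length (u # us')) * \<alpha>"
  have pos: "\<forall>u\<in>set (u # us'). 0 < u" "\<forall>u\<in>set us'. 0 < u" using assms(1) us by auto
  have rg: "restricted_growth [1]" by simp
  have "expectation (order_sum 0 us) = on_word [1] (order_sum 0 (u # us'))"
    unfolding on_word_def us
  proof (rule Bochner_Integration.integral_cong[OF refl])
    fix \<omega> assume \<omega>: "\<omega> \<in> space M"
    then have "word Y (length [1::nat]) \<omega> = [1]" using word_growth[OF \<omega>, of 1] by simp
    then show "order_sum 0 (u # us') \<omega> =
      indicator {\<omega> \<in> space M. word Y (length [1::nat]) \<omega> = [1]} \<omega> * order_sum 0 (u # us') \<omega>"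
      using \<omega> by (simp add: indicator_def)
  qed
  also have "\<dots> = on_word [1] (\<lambda>\<omega>. Q_prod (replicate_mset u 1) \<omega> * order_sum 1 us' \<omega>
      + Q_prod {#} \<omega> * order_sum 1 (u # us') \<omega>)"
    by (rule on_word_cong) (subst order_sum_rec[OF pos(1)], simp add: Q_prod_def)
  also have "\<dots> = on_word [1] (\<lambda>\<omega>. Q_prod (replicate_mset u 1) \<omega> * order_sum 1 us' \<omega>)
      + on_word [1] (\<lambda>\<omega>. Q_prod {#} \<omega> * order_sum 1 (u # us') \<omega>)"
    by (intro on_word_add bounded_rv_mult bounded_rv_Q_prod bounded_rv_order_sum pos)
  also have "on_word [1] (\<lambda>\<omega>. Q_prod (replicate_mset u 1) \<omega> * order_sum 1 us' \<omega>) =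
      (pochhammer (1 - \<alpha>) u * order_coeff \<alpha> us') * V (length us) (sum_list us + 1)"
    using order_moment[OF pos(2), unfolded order_moment_formula_def, rule_format, OF rg, of "replicate_mset u 1"]
      block_weight_add_new[of 1 "{#}" \<alpha> u]
    by (simp add: us block_weight_def add.commute split: if_splits)
  also have "pochhammer (1 - \<alpha>) u * order_coeff \<alpha> us' = s * order_coeff \<alpha> us"
    unfolding s_def us by (rule order_coeff_Cons[OF pos(1) alpha])
  also have "on_word [1] (\<lambda>\<omega>. Q_prod {#} \<omega> * order_sum 1 (u # us') \<omega>) =
      order_coeff \<alpha> us * V (length us + 1) (sum_list us + 1)"
    using order_moment[OF pos(1), unfolded order_moment_formula_def, rule_format, OF rg, of "{#}"]
      block_weight_add_new[of 1 "{#}" \<alpha> 0]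
    by (simp add: us block_weight_def add.commute del: order_coeff.simps)
  also have "s * order_coeff \<alpha> us * V (length us) (sum_list us + 1)
      + order_coeff \<alpha> us * V (length us + 1) (sum_list us + 1)
     = ((real (sum_list us) - real (length us) * \<alpha>) * V (length us) (sum_list us + 1)
      + V (length us + 1) (sum_list us + 1)) * order_coeff \<alpha> us"
    by (simp add: s_def us algebra_simps del: order_coeff.simps)
  also have "(real (sum_list us) - real (length us) * \<alpha>) * V (length us) (sum_list us + 1)
      + V (length us + 1) (sum_list us + 1) = V (length us) (sum_list us)"
    by (rule gibbs_weights_rec[symmetric, OF weights _ sum_list_ge_length[OF assms(1)]])
      (use assms(2) in \<open>simp add: Suc_le_eq\<close>)
  finally show ?thesis .
qed

end

section \<open>Labels of a consistent family of partitions\<close>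

definition block_rank :: "nat set set \<Rightarrow> nat set \<Rightarrow> nat" where
  "block_rank \<C> C = card {D \<in> \<C>. Min D \<le> Min C}"

text \<open>In a partition only one block contains \<open>x\<close>, and the union is that block.\<close>

definition cluster_label :: "nat set set \<Rightarrow> nat \<Rightarrow> nat" where
  "cluster_label \<C> x = block_rank \<C> (\<Union>{C \<in> \<C>. x \<in> C})"

definition level_sets :: "nat \<Rightarrow> (nat \<Rightarrow> nat) \<Rightarrow> nat set set" where
  "level_sets n f = (\<lambda>j. {x\<in>{1..n}. f x = j}) ` f ` {1..n}"

context
  fixes \<C> :: "nat set set" and n :: nat
  assumes part: "partition_on {1..n} \<C>"
begin

lemma partition_disjoint: "C \<in> \<C> \<Longrightarrow> D \<in> \<C> \<Longrightarrow> x \<in> C \<Longrightarrow> x \<in> D \<Longrightarrow> C = D"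
  using partition_onD2[OF part] by (auto simp: pairwise_def disjnt_def)

lemma partition_block: "C \<in> \<C> \<Longrightarrow> finite C \<and> C \<noteq> {} \<and> C \<subseteq> {1..n}"
proof -
  assume C: "C \<in> \<C>"
  then have "C \<subseteq> {1..n}" using partition_onD1[OF part] by blast
  then show ?thesis using C partition_onD3[OF part] finite_subset[of C "{1..n}"] by blast
qed

lemma partition_cover: "x \<in> {1..n} \<Longrightarrow> \<exists>C\<in>\<C>. x \<in> C"
  using partition_onD1[OF part] by auto

lemma finite_partition: "finite \<C>"
  by (rule finite_subset[of _ "Pow {1..n}"]) (use partition_block in auto)

lemma cluster_label_eq: "C \<in> \<C> \<Longrightarrow> x \<in> C \<Longrightarrow> cluster_label \<C> x = block_rank \<C> C"
proof -
  assume C: "C \<in> \<C>" "x \<in> C"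
  then have "{C \<in> \<C>. x \<in> C} = {C}" using partition_disjoint by auto
  then show ?thesis by (simp add: cluster_label_def)
qed

lemma block_rank_less:
  assumes "C \<in> \<C>" "D \<in> \<C>" "Min C < Min D"
  shows "block_rank \<C> C < block_rank \<C> D"
  unfolding block_rank_def
proof (rule psubset_card_mono)
  show "finite {E \<in> \<C>. Min E \<le> Min D}" using finite_partition by simp
  have "D \<in> {E \<in> \<C>. Min E \<le> Min D} - {E \<in> \<C>. Min E \<le> Min C}" using assms by simp
  moreover have "{E \<in> \<C>. Min E \<le> Min C} \<subseteq> {E \<in> \<C>. Min E \<le> Min D}" using assms(3) by auto
  ultimately show "{E \<in> \<C>. Min E \<le> Min C} \<subset> {E \<in> \<C>. Min E \<le> Min D}" by blast
qed

lemma inj_on_block_rank: "inj_on (block_rank \<C>) \<C>"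
proof (rule inj_onI)
  fix C D assume CD: "C \<in> \<C>" "D \<in> \<C>" and eq: "block_rank \<C> C = block_rank \<C> D"
  have "Min C = Min D"
    using block_rank_less[OF CD] block_rank_less[OF CD(2,1)] eq by (metis less_irrefl linorder_neqE_nat)
  moreover have "Min C \<in> C" "Min D \<in> D" using partition_block CD by auto
  ultimately show "C = D" using CD partition_disjoint by metis
qed

lemma block_rank_bounds: "C \<in> \<C> \<Longrightarrow> 1 \<le> block_rank \<C> C \<and> block_rank \<C> C \<le> card \<C>"
proof -
  assume C: "C \<in> \<C>"
  then have "{D \<in> \<C>. Min D \<le> Min C} \<noteq> {}" by auto
  then have "0 < block_rank \<C> C" unfolding block_rank_def using finite_partition by (simp add: card_gt_0_iff)
  moreover have "block_rank \<C> C \<le> card \<C>"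
    unfolding block_rank_def using finite_partition by (intro card_mono) auto
  ultimately show ?thesis by simp
qed

lemma nth_cluster_eq: "nth_cluster \<C> j = {x\<in>{1..n}. cluster_label \<C> x = j}"
proof (intro equalityI subsetI)
  fix x assume "x \<in> nth_cluster \<C> j"
  then obtain C where C: "C \<in> \<C>" "x \<in> C" "block_rank \<C> C = j"
    unfolding nth_cluster_def block_rank_def by blast
  then show "x \<in> {x\<in>{1..n}. cluster_label \<C> x = j}"
    using partition_block[OF C(1)] cluster_label_eq[OF C(1,2)] by auto
next
  fix x assume x: "x \<in> {x\<in>{1..n}. cluster_label \<C> x = j}"
  then obtain C where C: "C \<in> \<C>" "x \<in> C" using partition_cover[of x] by auto
  show "x \<in> nth_cluster \<C> j"
    unfolding nth_cluster_def block_rank_def[symmetric]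
  proof (rule UnionI)
    show "C \<in> {C \<in> \<C>. block_rank \<C> C = j}" using cluster_label_eq[OF C] x C(1) by simp
  qed (rule C(2))
qed

lemma labels_image: "cluster_label \<C> ` {1..n} = block_rank \<C> ` \<C>"
proof (intro equalityI subsetI)
  fix j assume "j \<in> cluster_label \<C> ` {1..n}"
  then obtain x where x: "x \<in> {1..n}" "j = cluster_label \<C> x" by (rule imageE)
  obtain C where C: "C \<in> \<C>" "x \<in> C" using partition_cover[OF x(1)] by (rule bexE)
  have "j = block_rank \<C> C" unfolding x(2) by (rule cluster_label_eq[OF C])
  then show "j \<in> block_rank \<C> ` \<C>" using C(1) by (rule image_eqI)
next
  fix j assume "j \<in> block_rank \<C> ` \<C>"
  then obtain C where C: "j = block_rank \<C> C" "C \<in> \<C>" by (rule imageE)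
  obtain x where x: "x \<in> C" using partition_block[OF C(2)] by auto
  have "j = cluster_label \<C> x" unfolding C(1) by (rule cluster_label_eq[OF C(2) x, symmetric])
  moreover have "x \<in> {1..n}" using partition_block[OF C(2)] x by auto
  ultimately show "j \<in> cluster_label \<C> ` {1..n}" by (rule image_eqI)
qed

lemma level_sets_cluster_label: "level_sets n (cluster_label \<C>) = \<C>"
proof -
  have "{x\<in>{1..n}. cluster_label \<C> x = block_rank \<C> C} = C" if C: "C \<in> \<C>" for C
  proof (rule set_eqI)
    fix x
    show "x \<in> {x\<in>{1..n}. cluster_label \<C> x = block_rank \<C> C} \<longleftrightarrow> x \<in> C"
    proof
      assume "x \<in> {x\<in>{1..n}. cluster_label \<C> x = block_rank \<C> C}"
      then obtain D where D: "D \<in> \<C>" "x \<in> D" "block_rank \<C> D = block_rank \<C> C"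
        using partition_cover[of x] cluster_label_eq by auto
      then show "x \<in> C" using inj_onD[OF inj_on_block_rank D(3,1) C] by simp
    next
      assume "x \<in> C"
      then show "x \<in> {x\<in>{1..n}. cluster_label \<C> x = block_rank \<C> C}"
        using cluster_label_eq[OF C] partition_block[OF C] by auto
    qed
  qed
  then show ?thesis unfolding level_sets_def labels_image image_image by simp
qed

text \<open>Only blocks whose least element is at most that of the block of \<open>x\<close> matter for the label, and these
  survive the restriction with unchanged least elements as long as \<open>x\<close> itself does.\<close>

lemma cluster_label_restrict:
  assumes "x \<in> {1..m}" "m \<le> n" and restr: "\<D> = {C \<inter> {1..m} | C. C \<in> \<C>} - {{}}"
  shows "cluster_label \<D> x = cluster_label \<C> x"
proof -
  obtain C where C: "C \<in> \<C>" "x \<in> C" using partition_cover[of x] assms by auto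
  have meet: "Min (D \<inter> {1..m}) = Min D \<and> Min D \<in> D \<inter> {1..m}" if D: "D \<in> \<C>" "D \<inter> {1..m} \<noteq> {}" for D
  proof -
    obtain z where z: "z \<in> D" "z \<le> m" using D(2) by auto
    have fin: "finite D" "D \<noteq> {}" "D \<subseteq> {1..n}" using partition_block[OF D(1)] by auto
    have "Min D \<in> D" using fin by simp
    moreover have "Min D \<le> m" using Min_le[OF fin(1) z(1)] z(2) by simp
    ultimately have *: "Min D \<in> D \<inter> {1..m}" using fin(3) by auto
    then have "Min (D \<inter> {1..m}) = Min D" using fin(1) by (intro Min_eqI) auto
    then show ?thesis using * by simp
  qed
  have CD: "C \<inter> {1..m} \<noteq> {}" using C assms(1) by auto
  have "{E \<in> \<D>. x \<in> E} = {C \<inter> {1..m}}"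
    using C assms(1) partition_disjoint unfolding restr by auto
  then have "cluster_label \<D> x = card {E \<in> \<D>. Min E \<le> Min (C \<inter> {1..m})}"
    by (simp add: cluster_label_def block_rank_def)
  also have "{E \<in> \<D>. Min E \<le> Min (C \<inter> {1..m})} = (\<lambda>D. D \<inter> {1..m}) ` {D \<in> \<C>. Min D \<le> Min C}"
  proof (intro equalityI subsetI)
    fix E assume "E \<in> {E \<in> \<D>. Min E \<le> Min (C \<inter> {1..m})}"
    then obtain D where D: "D \<in> \<C>" "E = D \<inter> {1..m}" "E \<noteq> {}" "Min E \<le> Min (C \<inter> {1..m})"
      unfolding restr by auto
    then show "E \<in> (\<lambda>D. D \<inter> {1..m}) ` {D \<in> \<C>. Min D \<le> Min C}"
      using meet[of D] meet[OF C(1) CD] by auto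
  next
    fix E assume "E \<in> (\<lambda>D. D \<inter> {1..m}) ` {D \<in> \<C>. Min D \<le> Min C}"
    then obtain D where D: "D \<in> \<C>" "E = D \<inter> {1..m}" "Min D \<le> Min C" by auto
    have "Min D \<in> D" using partition_block[OF D(1)] by auto
    moreover have "Min D \<le> m" using D(3) meet[OF C(1) CD] by auto
    moreover have "1 \<le> Min D" using \<open>Min D \<in> D\<close> partition_block[OF D(1)] by auto
    ultimately have "E \<noteq> {}" unfolding D(2) by (metis IntI atLeastAtMost_iff empty_iff)
    then show "E \<in> {E \<in> \<D>. Min E \<le> Min (C \<inter> {1..m})}"
      using D meet[of D] meet[OF C(1) CD] unfolding restr by auto
  qed
  also have "card \<dots> = card {D \<in> \<C>. Min D \<le> Min C}"
  proof (rule card_image, rule inj_onI)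
    fix D D' assume D: "D \<in> {D \<in> \<C>. Min D \<le> Min C}" "D' \<in> {D \<in> \<C>. Min D \<le> Min C}"
      and eq: "D \<inter> {1..m} = D' \<inter> {1..m}"
    have "Min D \<in> D" "1 \<le> Min D" using partition_block[of D] D by auto
    moreover have "Min D \<le> m" using D meet[OF C(1) CD] by auto
    ultimately have "Min D \<in> D \<inter> {1..m}" by simp
    then have "Min D \<in> D' \<inter> {1..m}" by (simp only: eq)
    then show "D = D'" using D partition_disjoint[of D D' "Min D"] \<open>Min D \<in> D\<close> by simp
  qed
  also have "\<dots> = cluster_label \<C> x" using cluster_label_eq[OF C] by (simp add: block_rank_def)
  finally show ?thesis .
qed

end

lemma level_sets_eqD:
  assumes "level_sets n f = level_sets n g" "x \<in> {1..n}" "x' \<in> {1..n}"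
  shows "f x = f x' \<longleftrightarrow> g x = g x'"
proof -
  have *: "g x = g x'" if "level_sets n f = level_sets n g" "f x = f x'" for f g
  proof -
    have "{z\<in>{1..n}. f z = f x} \<in> level_sets n g"
      using assms(2) that(1) unfolding level_sets_def by blast
    then obtain j where "{z\<in>{1..n}. f z = f x} = {z\<in>{1..n}. g z = j}"
      unfolding level_sets_def by auto
    then show ?thesis using assms(2,3) that(2) by (metis (mono_tags, lifting) mem_Collect_eq)
  qed
  show ?thesis using *[OF assms(1)] *[OF assms(1)[symmetric]] by blast
qed

text \<open>A restricted growth word is determined by the partition of its positions: an old letter is recovered from
  an earlier position in the same block, and a new letter can only be the successor of the number of
  letters before it.\<close>

lemma restricted_growth_unique:
  assumes "length y = length y'" "restricted_growth y" "restricted_growth y'"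
    and "\<And>i j. i < length y \<Longrightarrow> j < length y \<Longrightarrow> y ! i = y ! j \<longleftrightarrow> y' ! i = y' ! j"
  shows "y = y'"
  using assms
proof (induction y y' rule: list_induct2)
  case (Cons a y a' y')
  have kernel: "y ! i = y ! j \<longleftrightarrow> y' ! i = y' ! j" if "i < length y" "j < length y" for i j
    using Cons.prems(3)[of "Suc i" "Suc j"] that by simp
  have yy: "y = y'" using Cons kernel by simp
  have old: "a = y ! i \<longleftrightarrow> a' = y ! i" if "i < length y" for i
    using Cons.prems(3)[of 0 "Suc i"] that by (simp add: yy)
  have "a = a'"
  proof (cases "a \<in> set y")
    case True
    then show ?thesis using old by (metis in_set_conv_nth)
  next
    case False
    then have "a' \<notin> set y" using old by (metis in_set_conv_nth)
    moreover have "b = Suc (card (set y))" if "restricted_growth (b # y)" "b \<notin> set y" for b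
    proof -
      have "b \<notin> {1..card (set y)}" using that restricted_growth_set[of y] by simp
      then show ?thesis using that(1) by auto
    qed
    ultimately show ?thesis using False Cons.prems(1,2) yy by metis
  qed
  then show ?case using yy by simp
qed simp

lemma word_nth: "i < n \<Longrightarrow> word Y n \<omega> ! i = Y (n - i) \<omega>"
proof (induction n arbitrary: i)
  case (Suc n)
  then show ?case by (cases i) auto
qed simp

lemma set_word: "set (word Y n \<omega>) = (\<lambda>x. Y x \<omega>) ` {1..n}"
  by (induction n) (auto simp: atLeastAtMostSuc_conv)

lemma count_list_word: "count_list (word Y n \<omega>) j = card {x\<in>{1..n}. Y x \<omega> = j}"
proof (induction n)
  case (Suc n)
  have "{x\<in>{1..Suc n}. Y x \<omega> = j} = (if Y (Suc n) \<omega> = j then {Suc n} else {}) \<union> {x\<in>{1..n}. Y x \<omega> = j}"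
    by (auto simp: le_Suc_eq)
  then show ?case using Suc by simp
qed simp

text \<open>Positions are counted from the oldest letter, at the end of the list, starting with \<open>1\<close>.\<close>

definition letter :: "nat list \<Rightarrow> nat \<Rightarrow> nat" where
  "letter y x = y ! (length y - x)"

lemma word_letter: "word (\<lambda>x _. letter y x) (length y) \<omega> = y"
  by (rule nth_equalityI) (auto simp: word_nth letter_def)

lemma set_letter: "set y = letter y ` {1..length y}"
  using set_word[of "\<lambda>x _. letter y x" "length y"] unfolding word_letter .

lemma count_list_letter: "count_list y j = card {x\<in>{1..length y}. letter y x = j}"
  using count_list_word[of "\<lambda>x _. letter y x" "length y"] unfolding word_letter .

text \<open>A new element lies in a block met before or forms a new singleton block, so the number of labels
  grows by at most one.\<close>

lemma growth_word_labels:
  assumes "\<And>n. 1 \<le> n \<Longrightarrow> partition_on {1..n} (Rs n)"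
    and "\<And>m n. 1 \<le> m \<Longrightarrow> m < n \<Longrightarrow> Rs m = {C \<inter> {1..m} | C. C \<in> Rs n} - {{}}"
  defines "Y \<equiv> \<lambda>x _. cluster_label (Rs x) x"
  shows "1 \<le> x \<Longrightarrow> x \<le> n \<Longrightarrow> cluster_label (Rs x) x = cluster_label (Rs n) x"
    and "restricted_growth (word Y n \<omega>)"
proof -
  show lab: "cluster_label (Rs x) x = cluster_label (Rs n) x" if x: "1 \<le> x" "x \<le> n" for x n
  proof (cases "x = n")
    case False
    then show ?thesis using x assms(1)[of n] assms(2)[of x n]
      by (intro cluster_label_restrict[of n _ _ x]) auto
  qed simp
  have set_w: "set (word Y n \<omega>) = block_rank (Rs n) ` Rs n" if "1 \<le> n" for n
    unfolding set_word labels_image[OF assms(1)[OF that], symmetric]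
    by (rule image_cong) (use lab in \<open>auto simp: Y_def\<close>)
  have card_w: "card (set (word Y n \<omega>)) = card (Rs n)" if "1 \<le> n" for n
    using set_w[OF that] card_image[OF inj_on_block_rank[OF assms(1)[OF that]]] by simp
  show "restricted_growth (word Y n \<omega>)"
  proof (induction n)
    case (Suc n)
    have p: "partition_on {1..Suc n} (Rs (Suc n))" using assms(1) by simp
    have "cluster_label (Rs (Suc n)) (Suc n) \<in> block_rank (Rs (Suc n)) ` Rs (Suc n)"
      using labels_image[OF p] by force
    then have b: "1 \<le> cluster_label (Rs (Suc n)) (Suc n)"
      "cluster_label (Rs (Suc n)) (Suc n) \<le> card (Rs (Suc n))"
      using block_rank_bounds[OF p] by auto
    have "card (Rs (Suc n)) \<le> Suc (card (set (word Y n \<omega>)))"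
    proof (cases "n = 0")
      case True
      have "Rs 1 \<subseteq> {{1}}" using partition_block[OF p] True by (auto simp: subset_singleton_iff)
      then show ?thesis using True card_mono[of "{{1}}" "Rs 1"] by simp
    next
      case False
      have fin: "finite (Rs (Suc n))" by (rule finite_partition[OF p])
      have meets: "C \<inter> {1..n} \<noteq> {} \<longleftrightarrow> C \<noteq> {Suc n}" if "C \<in> Rs (Suc n)" for C
      proof -
        have "C \<noteq> {}" "C \<subseteq> insert (Suc n) {1..n}"
          using partition_block[OF p that] by (auto simp: atLeastAtMostSuc_conv)
        moreover have "Suc n \<notin> {1..n}" by simp
        ultimately show ?thesis by blast
      qed
      have "Rs n = (\<lambda>C. C \<inter> {1..n}) ` (Rs (Suc n) - {{Suc n}})"
      proof -
        have Rn: "Rs n = {C \<inter> {1..n} | C. C \<in> Rs (Suc n)} - {{}}"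
          using assms(2)[of n "Suc n"] False by simp
        show ?thesis unfolding Rn using meets by blast
      qed
      moreover have "inj_on (\<lambda>C. C \<inter> {1..n}) (Rs (Suc n) - {{Suc n}})"
      proof (rule inj_onI)
        fix C D assume CD: "C \<in> Rs (Suc n) - {{Suc n}}" "D \<in> Rs (Suc n) - {{Suc n}}"
          and eq: "C \<inter> {1..n} = D \<inter> {1..n}"
        have "C \<inter> {1..n} \<noteq> {}" using meets CD by blast
        then show "C = D" using eq CD partition_disjoint[OF p, of C D] by blast
      qed
      ultimately have "card (Rs n) = card (Rs (Suc n) - {{Suc n}})" by (simp add: card_image)
      then show ?thesis using card_w[of n] False fin by (simp add: card_Diff_singleton_if split: if_splits)
    qed
    then show ?case using Suc b by (simp add: Y_def)
  qed simp
qed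

lemma level_sets_cong:
  "(\<And>x. x \<in> {1..n} \<Longrightarrow> f x = g x) \<Longrightarrow> level_sets n f = level_sets n g"
proof -
  assume fg: "\<And>x. x \<in> {1..n} \<Longrightarrow> f x = g x"
  have "f ` {1..n} = g ` {1..n}" by (rule image_cong[OF refl fg])
  moreover have "{x \<in> {1..n}. f x = j} = {x \<in> {1..n}. g x = j}" for j using fg by auto
  ultimately show ?thesis unfolding level_sets_def by simp
qed

section \<open>Gibbs partitions as random words\<close>

text \<open>This turns word events into events of the form to which the EPPF applies.\<close>

lemma word_eq_iff_partition_eq:
  assumes "\<And>n. 1 \<le> n \<Longrightarrow> partition_on {1..n} (Rs n)"
    and "\<And>m n. 1 \<le> m \<Longrightarrow> m < n \<Longrightarrow> Rs m = {C \<inter> {1..m} | C. C \<in> Rs n} - {{}}"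
    and y: "restricted_growth y" "y \<noteq> []" and Y: "\<And>x. Y x \<omega> = cluster_label (Rs x) x"
  shows "word Y (length y) \<omega> = y \<longleftrightarrow> Rs (length y) = level_sets (length y) (letter y)"
proof -
  define n where "n = length y"
  have n: "1 \<le> n" using y(2) by (simp add: n_def Suc_le_eq)
  define w where "w = word Y n \<omega>"
  have w_eq: "w = word (\<lambda>x _. cluster_label (Rs x) x) n \<omega>"
    unfolding w_def by (induction n) (simp_all add: Y)
  have len: "length w = n" by (simp add: w_def)
  have letter_w: "letter w x = cluster_label (Rs n) x" if "x \<in> {1..n}" for x
    using growth_word_labels(1)[OF assms(1,2), of x n] that
    by (simp add: letter_def len w_def word_nth Y)
  have Rs: "Rs n = level_sets n (letter w)"
    using level_sets_cluster_label[OF assms(1)[OF n]] level_sets_cong[of n "letter w", OF letter_w] by simp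
  have "w = y" if eq: "Rs n = level_sets n (letter y)"
  proof (rule restricted_growth_unique)
    show "restricted_growth w" unfolding w_eq by (rule growth_word_labels(2)[OF assms(1,2)])
    show "w ! i = w ! j \<longleftrightarrow> y ! i = y ! j" if "i < length w" "j < length w" for i j
    proof -
      have "letter w (n - i) = letter w (n - j) \<longleftrightarrow> letter y (n - i) = letter y (n - j)"
        by (rule level_sets_eqD[of n]) (use Rs eq that in \<open>auto simp: len\<close>)
      then show ?thesis using that by (simp add: letter_def len n_def[symmetric])
    qed
  qed (simp_all add: len n_def y)
  then show ?thesis using Rs unfolding w_def n_def by auto
qed

lemma letter_blocks:
  fixes y :: "nat list"
  assumes y: "restricted_growth y" "y \<noteq> []"
  defines "Cs \<equiv> map (\<lambda>j. {x\<in>{1..length y}. letter y x = j}) [1..<Suc (card (set y))]"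
  shows "set Cs = level_sets (length y) (letter y)"
    and "distinct Cs"
    and "partition_on {1..length y} (set Cs)"
    and "is_composition (length y) (map card Cs)"
    and "length (map card Cs) = card (set y)"
    and "(\<Prod>m\<leftarrow>map card Cs. pochhammer (1 - \<alpha>) (m - 1)) = block_weight \<alpha> (mset y)"
proof -
  have sety: "set [1..<Suc (card (set y))] = set y"
  proof -
    have "set [1..<Suc (card (set y))] = {1..card (set y)}" by auto
    then show ?thesis using restricted_growth_set[OF y(1)] by metis
  qed
  have im: "letter y ` {1..length y} = set y" by (rule set_letter[symmetric])
  show 1: "set Cs = level_sets (length y) (letter y)"
    unfolding Cs_def set_map sety level_sets_def im ..
  show "distinct Cs"
    unfolding Cs_def distinct_map
  proof (intro conjI inj_onI)
    fix j j' assume j: "j \<in> set [1..<Suc (card (set y))]"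
      and eq: "{x \<in> {1..length y}. letter y x = j} = {x \<in> {1..length y}. letter y x = j'}"
    have "j \<in> letter y ` {1..length y}" using j unfolding sety im .
    then obtain x where "j = letter y x" "x \<in> {1..length y}" by (rule imageE)
    then have "x \<in> {x \<in> {1..length y}. letter y x = j'}" unfolding eq[symmetric] by simp
    then show "j = j'" using \<open>j = letter y x\<close> by simp
  qed simp
  show "partition_on {1..length y} (set Cs)"
    unfolding 1 level_sets_def
    by (rule partition_onI) (auto simp: disjnt_def)
  have cards: "map card Cs = map (count_list y) [1..<Suc (card (set y))]"
    by (simp add: Cs_def count_list_letter)
  have "sum_list (map (count_list y) [1..<Suc (card (set y))]) = (\<Sum>j\<in>set y. count_list y j)"
    by (subst sum.distinct_set_conv_list[symmetric]) (simp_all only: sety distinct_upt)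
  also have "\<dots> = length y" by (simp add: sum_count_set)
  finally show "is_composition (length y) (map card Cs)"
    unfolding is_composition_def cards set_map sety
    by (auto simp: count_list_0_iff intro: gr0I)
  show "length (map card Cs) = card (set y)" unfolding Cs_def length_map length_upt by simp
  have "(\<Prod>m\<leftarrow>map card Cs. pochhammer (1 - \<alpha>) (m - 1)) =
     (\<Prod>j\<leftarrow>[1..<Suc (card (set y))]. pochhammer (1 - \<alpha>) (count_list y j - 1))"
    unfolding cards by (simp add: comp_def)
  also have "\<dots> = (\<Prod>j\<in>set y. pochhammer (1 - \<alpha>) (count_list y j - 1))"
    by (subst prod.distinct_set_conv_list[symmetric]) (simp_all only: sety distinct_upt)
  finally show "(\<Prod>m\<leftarrow>map card Cs. pochhammer (1 - \<alpha>) (m - 1)) = block_weight \<alpha> (mset y)"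
    by (simp add: block_weight_def count_list_mset)
qed

lemma gibbs_frequencies_exist:
  fixes M :: "'a measure"
  assumes "prob_space M" "0 \<le> \<alpha>" "\<alpha> < 1" "gibbs_partition M \<alpha> R"
    and freq: "size_biased_limit_frequencies M R P"
    and pos: "AE \<omega> in M. \<forall>j\<ge>1. 0 < P j \<omega>"
    and sum1: "AE \<omega> in M. ((\<lambda>j. P j \<omega>) has_sum 1) {1..}"
  shows "\<exists>V Q. gibbs_frequencies M \<alpha> V (\<lambda>x \<omega>. cluster_label (R x \<omega>) x) Q
     \<and> (AE \<omega> in M. \<forall>j\<ge>1. Q j \<omega> = P j \<omega>)"
proof -
  interpret prob_space M by fact
  define Y where "Y = (\<lambda>x \<omega>. cluster_label (R x \<omega>) x)"
  from assms(4) obtain p V where rp: "random_partition M R" and ep: "has_eppf M R p"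
    and gw: "gibbs_weights \<alpha> V"
    and p: "\<And>n ns. 1 \<le> n \<Longrightarrow> is_composition n ns \<Longrightarrow>
      p ns = V (length ns) n * (\<Prod>m\<leftarrow>ns. pochhammer (1 - \<alpha>) (m - 1))"
    unfolding gibbs_partition_def by blast
  have Rmeas: "R n \<in> measurable M (count_space {\<C>. partition_on {1..n} \<C>})" if "1 \<le> n" for n
    using rp that unfolding random_partition_def by simp
  have Rpart: "partition_on {1..n} (R n \<omega>)" if "1 \<le> n" "\<omega> \<in> space M" for n \<omega>
    using measurable_space[OF Rmeas[OF that(1)] that(2)] by simp
  have Rrestr: "R m \<omega> = {C \<inter> {1..m} | C. C \<in> R n \<omega>} - {{}}" if "1 \<le> m" "m < n" "\<omega> \<in> space M" for m n \<omega>
    using rp that unfolding random_partition_def by blast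
  have growth: "restricted_growth (word Y n \<omega>)" if "\<omega> \<in> space M" for n \<omega>
  proof -
    have "word Y n \<omega> = word (\<lambda>x _. cluster_label (R x \<omega>) x) n \<omega>"
      by (induction n) (simp_all add: Y_def)
    then show ?thesis
      using growth_word_labels(2)[of "\<lambda>n. R n \<omega>" n \<omega>] Rpart Rrestr that by simp
  qed
  have event: "{\<omega>\<in>space M. word Y (length y) \<omega> = y} =
      {\<omega>\<in>space M. R (length y) \<omega> = level_sets (length y) (letter y)}"
    if y: "restricted_growth y" "y \<noteq> []" for y
  proof (rule Collect_cong, rule conj_cong[OF refl])
    fix \<omega> assume "\<omega> \<in> space M"
    then show "word Y (length y) \<omega> = y \<longleftrightarrow> R (length y) \<omega> = level_sets (length y) (letter y)"
      using word_eq_iff_partition_eq[of "\<lambda>n. R n \<omega>", OF _ _ y, of Y \<omega>] Rpart Rrestr by (simp add: Y_def)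
  qed
  have word_event_sets: "{\<omega>\<in>space M. word Y n \<omega> = y} \<in> sets M" for n y
  proof (cases "length y = n \<and> y \<noteq> [] \<and> restricted_growth y")
    case True
    then have y: "restricted_growth y" "y \<noteq> []" "n = length y" by auto
    have n: "1 \<le> n" using y by (simp add: Suc_le_eq)
    have "partition_on {1..n} (level_sets n (letter y))"
      using letter_blocks(1,3)[OF y(1,2)] by (simp add: y(3))
    then have "R n -` {level_sets n (letter y)} \<inter> space M \<in> sets M"
      by (intro measurable_sets[OF Rmeas[OF n]]) simp
    also have "R n -` {level_sets n (letter y)} \<inter> space M = {\<omega>\<in>space M. R n \<omega> = level_sets n (letter y)}"
      by auto
    finally show ?thesis using event[OF y(1,2)] by (simp add: y(3))
  next
    case False
    then consider "n = 0" "y = []" | "\<And>\<omega>. \<omega> \<in> space M \<Longrightarrow> word Y n \<omega> \<noteq> y"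
      using growth by (metis length_word length_0_conv)
    then show ?thesis
    proof cases
      case 2
      then have "{\<omega>\<in>space M. word Y n \<omega> = y} = {}" by blast
      then show ?thesis by (metis sets.empty_sets)
    qed simp
  qed
  have prob_word: "prob {\<omega>\<in>space M. word Y (length y) \<omega> = y} = gibbs_prob \<alpha> V (mset y)"
    if y: "restricted_growth y" "y \<noteq> []" for y
  proof -
    define Cs where "Cs = map (\<lambda>j. {x\<in>{1..length y}. letter y x = j}) [1..<Suc (card (set y))]"
    note Cs = letter_blocks[OF y, folded Cs_def]
    have n: "1 \<le> length y" using y(2) by (simp add: Suc_le_eq)
    have "prob {\<omega>\<in>space M. word Y (length y) \<omega> = y} = prob {\<omega>\<in>space M. R (length y) \<omega> = set Cs}"
      unfolding event[OF y] Cs(1) ..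
    also have "\<dots> = p (map card Cs)"
      using ep n Cs(2,3) unfolding has_eppf_def by blast
    also have "\<dots> = V (card (set y)) (length y) * block_weight \<alpha> (mset y)"
      unfolding p[OF n Cs(4)] Cs(5,6) ..
    finally show ?thesis by (simp add: gibbs_prob_def)
  qed
  have "AE \<omega> in M. (\<forall>j\<ge>1. 0 < P j \<omega>) \<and> ((\<lambda>j. P j \<omega>) has_sum 1) {1..}"
    using pos sum1 by (rule AE_conjI)
  then obtain N where N: "{\<omega>\<in>space M. \<not> ((\<forall>j\<ge>1. 0 < P j \<omega>) \<and> ((\<lambda>j. P j \<omega>) has_sum 1) {1..})} \<subseteq> N"
    "emeasure M N = 0" "N \<in> sets M" by (rule AE_E)
  \<comment> \<open>off the null set \<open>N\<close> the frequencies are positive and sum to \<open>1\<close>; on \<open>N\<close> they are replaced by \<open>0\<close>\<close>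
  define Q where "Q = (\<lambda>j \<omega>. if 1 \<le> j \<and> \<omega> \<in> space M - N then P j \<omega> else 0)"
  have good: "(\<forall>j\<ge>1. 0 < P j \<omega>) \<and> ((\<lambda>j. P j \<omega>) has_sum 1) {1..}" if "\<omega> \<in> space M - N" for \<omega>
    using N(1) that by blast
  have sums: "(\<lambda>j. Q j \<omega>) sums (if \<omega> \<in> space M - N then 1 else 0)" for \<omega>
  proof (cases "\<omega> \<in> space M - N")
    case True
    have "((\<lambda>j. Q j \<omega>) has_sum 1) UNIV \<longleftrightarrow> ((\<lambda>j. P j \<omega>) has_sum 1) {1..}"
      by (rule has_sum_cong_neutral) (use True in \<open>auto simp: Q_def\<close>)
    then show ?thesis using good[OF True] True has_sum_imp_sums by fastforce
  next
    case False
    then have "Q j \<omega> = 0" for j by (auto simp: Q_def)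
    then have "(\<lambda>j. Q j \<omega>) = (\<lambda>j. 0)" by blast
    then show ?thesis unfolding if_not_P[OF False] by simp
  qed
  have AE_N: "AE \<omega> in M. \<omega> \<in> space M - N"
  proof -
    have "AE \<omega> in M. \<omega> \<notin> N" by (rule AE_not_in) (use N in \<open>simp add: null_sets_def\<close>)
    with AE_space show ?thesis by eventually_elim simp
  qed
  have QP: "AE \<omega> in M. \<forall>j\<ge>1. Q j \<omega> = P j \<omega>"
    using AE_N by eventually_elim (simp add: Q_def)
  have "gibbs_frequencies M \<alpha> V Y Q"
  proof
    show "0 \<le> \<alpha>" "\<alpha> < 1" "gibbs_weights \<alpha> V" by fact+
    show "word Y m \<in> measurable M (count_space UNIV)" for m
      unfolding measurable_count_space_eq2_countable
    proof (intro conjI ballI)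
      fix y
      have "word Y m -` {y} \<inter> space M = {\<omega>\<in>space M. word Y m \<omega> = y}" by auto
      then show "word Y m -` {y} \<inter> space M \<in> sets M" using word_event_sets by simp
    qed simp
    show "restricted_growth (word Y m \<omega>)" if "\<omega> \<in> space M" for \<omega> m by (rule growth[OF that])
    show "prob {\<omega> \<in> space M. word Y (length y) \<omega> = y} = gibbs_prob \<alpha> V (mset y)"
      if "restricted_growth y" "y \<noteq> []" for y by (rule prob_word[OF that])
    show "Q j \<in> borel_measurable M" for j
    proof (cases "1 \<le> j")
      case True
      then have [measurable]: "P j \<in> borel_measurable M"
        using freq unfolding size_biased_limit_frequencies_def by blast
      have [measurable]: "N \<in> sets M" by fact
      show ?thesis using True unfolding Q_def by simp
    next
      case False
      then show ?thesis by (simp add: Q_def)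
    qed
    show "0 \<le> Q j \<omega>" for j \<omega> using good[of \<omega>] by (auto simp: Q_def less_imp_le)
    show "summable (\<lambda>j. Q j \<omega>)" for \<omega> using sums by (rule sums_summable)
    show "(\<Sum>j. Q j \<omega>) \<le> 1" for \<omega> using sums_unique[OF sums[of \<omega>]] by (simp split: if_splits)
    show "Q 0 \<omega> = 0" for \<omega> by (simp add: Q_def)
    show "AE \<omega> in M. (\<Sum>j. Q j \<omega>) = 1"
      using AE_N
    proof eventually_elim
      case (elim \<omega>)
      then show ?case using sums_unique[OF sums[of \<omega>]] by simp
    qed
    show "AE \<omega> in M. \<forall>j\<ge>1. 0 < Q j \<omega>"
      using AE_N by eventually_elim (use good in \<open>auto simp: Q_def\<close>)
    have "AE \<omega> in M. \<forall>j. 1 \<le> j \<longrightarrow>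
        (\<lambda>n. real (card (nth_cluster (R n \<omega>) j)) / real n) \<longlonglongrightarrow> P j \<omega>"
      unfolding AE_all_countable using freq by (auto simp: size_biased_limit_frequencies_def)
    then show "AE \<omega> in M. \<forall>j\<ge>1. (\<lambda>n. real (count_list (word Y n \<omega>) j) / real n) \<longlonglongrightarrow> Q j \<omega>"
      using QP AE_space
    proof eventually_elim
      case (elim \<omega>)
      have "real (count_list (word Y n \<omega>) j) / real n = real (card (nth_cluster (R n \<omega>) j)) / real n" for n j
      proof (cases "n = 0")
        case False
        then have n: "1 \<le> n" by simp
        have "{x\<in>{1..n}. Y x \<omega> = j} = {x\<in>{1..n}. cluster_label (R n \<omega>) x = j}"
          using growth_word_labels(1)[of "\<lambda>n. R n \<omega>" _ n] Rpart Rrestr elim(3)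
          by (intro Collect_cong) (auto simp: Y_def)
        then show ?thesis
          unfolding count_list_word nth_cluster_eq[OF Rpart[OF n elim(3)]] by simp
      qed simp
      then have "(\<lambda>n. real (count_list (word Y n \<omega>) j) / real n) =
          (\<lambda>n. real (card (nth_cluster (R n \<omega>) j)) / real n)" for j by blast
      then show ?case using elim by simp
    qed
  qed
  then show ?thesis using QP unfolding Y_def by blast
qed

text \<open>Conditional independence gives the conditional probability of the event as a product of
  frequencies; integrating it removes the conditioning.\<close>

lemma sample_prob:
  fixes M :: "'a measure"
  assumes "prob_space M" and P: "\<And>j. 1 \<le> j \<Longrightarrow> P j \<in> borel_measurable M"
    and X: "random_sample M P X" and x: "\<And>i. i \<in> {1..n} \<Longrightarrow> 1 \<le> x i" and n: "1 \<le> n"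
    and sets: "{\<omega>\<in>space M. \<forall>i\<in>{1..n}. X i \<omega> = x i} \<in> sets M"
  shows "measure M {\<omega>\<in>space M. \<forall>i\<in>{1..n}. X i \<omega> = x i} = (\<integral>\<omega>. (\<Prod>i\<in>{1..n}. P (x i) \<omega>) \<partial>M)"
proof -
  interpret prob_space M by fact
  define F where "F = generated_algebra M P"
  have "sets F \<subseteq> sets M" unfolding F_def generated_algebra_def
    by (subst sets_measure_of) (auto intro!: sets.sigma_sets_subset measurable_sets[OF P])
  then have "subalgebra M F" by (simp add: subalgebra_def F_def generated_algebra_def space_measure_of_conv)
  then interpret finite_measure_subalgebra M F by unfold_locales
  let ?E = "{\<omega>\<in>space M. \<forall>i\<in>{1..n}. X i \<omega> = x i}"
  have "AE \<omega> in M. cond_probability M F ?E \<omega> =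
      (\<Prod>i\<in>{1..n}. cond_probability M F {\<omega>\<in>space M. X i \<omega> = x i} \<omega>)"
  proof -
    have "cond_indep_vars M F (count_space {1..}) X {1..}"
      using X by (simp add: random_sample_def F_def)
    from this[unfolded cond_indep_vars_def, THEN conjunct2, rule_format, of "{1..n}" "\<lambda>i. {x i}"]
    show ?thesis using x n by simp
  qed
  moreover have "AE \<omega> in M. \<forall>i\<in>{1..n}. cond_probability M F {\<omega>\<in>space M. X i \<omega> = x i} \<omega> = P (x i) \<omega>"
    using X x by (intro AE_ball_countable[THEN iffD2]) (auto simp: random_sample_def F_def)
  ultimately have AE: "AE \<omega> in M. cond_probability M F ?E \<omega> = (\<Prod>i\<in>{1..n}. P (x i) \<omega>)"
  proof eventually_elim
    case (elim \<omega>)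
    then show ?case using prod.cong[OF refl, of "{1..n}" "\<lambda>i. cond_probability M F {\<omega>\<in>space M. X i \<omega> = x i} \<omega>"
      "\<lambda>i. P (x i) \<omega>"] by simp
  qed
  have int: "integrable M (indicator ?E :: 'a \<Rightarrow> real)"
    using sets by (intro integrable_real_indicator) (auto simp: emeasure_eq_measure)
  have "prob ?E = (\<integral>\<omega>. indicator ?E \<omega> \<partial>M)" using sets by simp
  also have "\<dots> = (\<integral>\<omega>. cond_probability M F ?E \<omega> \<partial>M)"
    unfolding cond_probability_def by (rule real_cond_exp_int(2)[OF int, symmetric])
  also have "\<dots> = (\<integral>\<omega>. (\<Prod>i\<in>{1..n}. P (x i) \<omega>) \<partial>M)"
  proof (rule integral_cong_AE[OF _ _ AE])
    show "cond_probability M F ?E \<in> borel_measurable M"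
      unfolding cond_probability_def by simp
    show "(\<lambda>\<omega>. \<Prod>i\<in>{1..n}. P (x i) \<omega>) \<in> borel_measurable M"
      by (intro borel_measurable_prod P x)
  qed
  finally show ?thesis .
qed

section \<open>Value patterns of a sample\<close>

definition increasing_lists :: "nat \<Rightarrow> nat \<Rightarrow> nat list set" where
  "increasing_lists K l = {J. length J = l \<and> sorted_wrt (<) J \<and> (\<forall>j\<in>set J. K < j)}"

definition freq_monomial :: "(nat \<Rightarrow> real) \<Rightarrow> nat list \<Rightarrow> nat list \<Rightarrow> real" where
  "freq_monomial q us J = (\<Prod>r<length us. q (J ! r) ^ (us ! r))"

lemma freq_monomial_Cons:
  "freq_monomial q (u # us) (j # J) = q j ^ u * freq_monomial q us J"
  unfolding freq_monomial_def length_Cons prod.lessThan_Suc_shift by simp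

lemma freq_monomial_nonneg: "(\<And>j. 0 \<le> q j) \<Longrightarrow> 0 \<le> freq_monomial q us J"
  unfolding freq_monomial_def by (intro prod_nonneg) simp

lemma bij_betw_increasing_lists:
  "bij_betw (\<lambda>(i, J). (Suc K + i) # J)
     (SIGMA i:UNIV. increasing_lists (Suc K + i) l) (increasing_lists K (Suc l))"
proof (rule bij_betwI[where g="\<lambda>J. (hd J - Suc K, tl J)"])
  show "(\<lambda>J. (hd J - Suc K, tl J)) \<in> increasing_lists K (Suc l) \<rightarrow>
      (SIGMA i:UNIV. increasing_lists (Suc K + i) l)"
  proof
    fix J assume J: "J \<in> increasing_lists K (Suc l)"
    then obtain j J' where J': "J = j # J'" by (cases J) (auto simp: increasing_lists_def)
    show "(hd J - Suc K, tl J) \<in> (SIGMA i:UNIV. increasing_lists (Suc K + i) l)"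
      using J unfolding J' by (auto simp: increasing_lists_def)
  qed
  show "(case (hd J - Suc K, tl J) of (i, J) \<Rightarrow> (Suc K + i) # J) = J"
    if "J \<in> increasing_lists K (Suc l)" for J
    using that by (cases J) (auto simp: increasing_lists_def)
qed (fastforce simp: increasing_lists_def)+

text \<open>Splitting off the first entry of an increasing list matches the recursion of \<open>tail_sum\<close>; working
  with nonnegative integrals over counting measures makes the rearrangement unconditional.\<close>

lemma nn_integral_freq_monomial:
  assumes q: "\<And>j. 0 \<le> q j" "summable q" "suminf q \<le> 1" and us: "\<forall>u\<in>set us. 0 < u"
  shows "(\<integral>\<^sup>+J. ennreal (freq_monomial q us J) \<partial>count_space (increasing_lists K (length us)))
    = ennreal (tail_sum q K us)"
  using us
proof (induction us arbitrary: K)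
  case Nil
  have "increasing_lists K 0 = {[]}" by (auto simp: increasing_lists_def)
  then show ?case by (simp add: nn_integral_count_space_finite freq_monomial_def)
next
  case (Cons u us)
  let ?S = "SIGMA i:UNIV. increasing_lists (Suc K + i) (length us)"
  let ?g = "\<lambda>i J. ennreal (q (Suc K + i) ^ u) * ennreal (freq_monomial q us J)"
  have pos: "\<forall>u\<in>set us. 0 < u" "0 < u" using Cons.prems by auto
  note aux = tail_sum_bounds[of q, OF q pos(1)]
  have "(\<integral>\<^sup>+J. ennreal (freq_monomial q (u # us) J) \<partial>count_space (increasing_lists K (Suc (length us))))
     = (\<integral>\<^sup>+x. ennreal (freq_monomial q (u # us) (case x of (i, J) \<Rightarrow> (Suc K + i) # J)) \<partial>count_space ?S)"
    by (rule nn_integral_bij_count_space[OF bij_betw_increasing_lists, symmetric])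
  also have "\<dots> = (\<integral>\<^sup>+x. (case x of (i, J) \<Rightarrow> ?g i J) \<partial>count_space ?S)"
    by (rule nn_integral_cong)
      (auto simp: freq_monomial_Cons ennreal_mult q(1) freq_monomial_nonneg split: prod.split)
  also have "\<dots> = (\<integral>\<^sup>+x. (case x of (i, J) \<Rightarrow> ?g i J) * indicator ?S x \<partial>count_space UNIV)"
    by (rule nn_integral_count_space_indicator) simp
  also have "\<dots> = (\<integral>\<^sup>+i. \<integral>\<^sup>+J. ?g i J * indicator ?S (i, J) \<partial>count_space UNIV \<partial>count_space UNIV)"
    by (subst nn_integral_fst_count_space[symmetric]) simp
  also have "\<dots> = (\<integral>\<^sup>+i. \<integral>\<^sup>+J. ?g i J * indicator (increasing_lists (Suc K + i) (length us)) J
      \<partial>count_space UNIV \<partial>count_space UNIV)"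
    by (intro nn_integral_cong) (auto simp: indicator_def)
  also have "\<dots> = (\<integral>\<^sup>+i. \<integral>\<^sup>+J. ?g i J \<partial>count_space (increasing_lists (Suc K + i) (length us)) \<partial>count_space UNIV)"
    by (intro nn_integral_cong nn_integral_count_space_indicator[symmetric]) simp
  also have "\<dots> = (\<integral>\<^sup>+i. ennreal (q (Suc K + i) ^ u * tail_sum q (Suc K + i) us) \<partial>count_space UNIV)"
  proof (intro nn_integral_cong)
    fix i
    have "(\<integral>\<^sup>+J. ?g i J \<partial>count_space (increasing_lists (Suc K + i) (length us))) =
       ennreal (q (Suc K + i) ^ u) * ennreal (tail_sum q (Suc K + i) us)"
      using Cons.IH[OF pos(1), of "Suc K + i"] by (subst nn_integral_cmult) auto
    then show "(\<integral>\<^sup>+J. ?g i J \<partial>count_space (increasing_lists (Suc K + i) (length us))) =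
       ennreal (q (Suc K + i) ^ u * tail_sum q (Suc K + i) us)"
      using aux(1) q(1) by (simp add: ennreal_mult)
  qed
  also have "\<dots> = ennreal (tail_sum q K (u # us))"
    unfolding nn_integral_count_space_nat tail_sum.simps
    by (rule suminf_ennreal2) (use aux(1) aux(2)[OF pos(2)] q(1) in auto)
  finally show ?case by simp
qed

lemma prod_list_map_count:
  fixes g :: "nat \<Rightarrow> 'b::comm_monoid_mult"
  assumes "set f \<subseteq> {..<k}"
  shows "prod_list (map g f) = (\<Prod>r<k. g r ^ count_list f r)"
  using assms
proof (induction f)
  case (Cons a f)
  have "(\<Prod>r<k. g r ^ count_list (a # f) r) =
      (\<Prod>r<k. (if r = a then g r else 1) * g r ^ count_list f r)"
    by (rule prod.cong) auto
  also have "\<dots> = g a * (\<Prod>r<k. g r ^ count_list f r)"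
    using Cons.prems by (simp add: prod.distrib)
  finally show ?case using Cons by simp
qed simp

definition observations :: "(nat \<Rightarrow> 'a \<Rightarrow> nat) \<Rightarrow> nat \<Rightarrow> 'a \<Rightarrow> nat list" where
  "observations X n \<omega> = map (\<lambda>i. X i \<omega>) [1..<Suc n]"

lemma observations_Suc: "observations X (Suc n) \<omega> = observations X n \<omega> @ [X (Suc n) \<omega>]"
  by (simp add: observations_def)

lemma length_observations [simp]: "length (observations X n \<omega>) = n"
  by (simp add: observations_def)

lemma set_observations: "set (observations X n \<omega>) = (\<lambda>i. X i \<omega>) ` {1..n}"
  unfolding observations_def set_map set_upt by (rule image_cong) auto

text \<open>The pattern \<open>f\<close> of a sample lists the ranks, starting at \<open>0\<close>, of the observed values among the distinct
  values that occur: the sample is \<open>map ((!) J) f\<close> for the increasing list \<open>J\<close> of these values.\<close>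

definition pattern_counts :: "nat list \<Rightarrow> nat list" where
  "pattern_counts f = map (count_list f) [0..<card (set f)]"

definition value_patterns :: "nat list \<Rightarrow> nat list set" where
  "value_patterns ns = {f. set f = {..<length ns} \<and> pattern_counts f = ns}"

lemma value_patternsD:
  assumes "f \<in> value_patterns ns"
  shows "set f = {..<length ns}" "card (set f) = length ns" "r < length ns \<Longrightarrow> count_list f r = ns ! r"
    and "length f = sum_list ns" "\<forall>m\<in>set ns. 0 < m"
proof -
  show f: "set f = {..<length ns}" using assms by (simp add: value_patterns_def)
  then show c: "card (set f) = length ns" by simp
  have ns: "ns = map (count_list f) [0..<length ns]"
    using assms c by (simp add: value_patterns_def pattern_counts_def)
  show "r < length ns \<Longrightarrow> count_list f r = ns ! r"
    by (subst ns) simp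
  have "sum_list ns = sum_list (map (count_list f) [0..<length ns])" by (rule arg_cong[OF ns])
  also have "\<dots> = (\<Sum>r\<in>set f. count_list f r)"
    by (simp only: sum.distinct_set_conv_list[symmetric] distinct_upt set_upt f lessThan_atLeast0)
  finally show "length f = sum_list ns" by (simp add: sum_count_set)
  show "\<forall>m\<in>set ns. 0 < m"
  proof
    fix m assume "m \<in> set ns"
    then have "m \<in> count_list f ` set [0..<length ns]" by (subst (asm) ns) (simp only: set_map)
    then obtain r where r: "m = count_list f r" "r \<in> set [0..<length ns]" by (rule imageE)
    then have "r \<in> set f" unfolding f by simp
    then show "0 < m" unfolding r(1) by (metis count_list_0_iff gr0I)
  qed
qed

lemma increasing_list_sorted:
  assumes "J \<in> increasing_lists 0 k"
  shows "sorted_list_of_set (set J) = J" "distinct J" "length J = k"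
  using assms sorted_list_of_set.idem_if_sorted_distinct[of J]
  by (auto simp: increasing_lists_def strict_sorted_iff)

lemma set_map_nth: "set f = {..<length J} \<Longrightarrow> set (map ((!) J) f) = set J"
proof -
  assume f: "set f = {..<length J}"
  have "set J = (!) J ` {..<length J}" by (auto simp: set_conv_nth)
  then show ?thesis unfolding set_map f by simp
qed

lemma value_pattern_unique:
  assumes "J \<in> increasing_lists 0 k" "J' \<in> increasing_lists 0 k'"
    and "set f = {..<k}" "set f' = {..<k'}" "map ((!) J) f = map ((!) J') f'"
  shows "J = J'" "f = f'"
proof -
  note J = increasing_list_sorted[OF assms(1)] and J' = increasing_list_sorted[OF assms(2)]
  have "set J = set J'"
    using set_map_nth[of f J] set_map_nth[of f' J'] assms(3-5) J(3) J'(3) by simp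
  then show JJ: "J = J'" using J(1) J'(1) by metis
  then have "inj_on ((!) J) (set f \<union> set f')"
    using J(2,3) J'(3) assms(3,4) by (intro inj_on_nth) auto
  then show "f = f'" using assms(5) JJ by (simp add: inj_on_map_eq_map)
qed

lemma value_pattern_exists:
  assumes "\<forall>v\<in>set xs. 0 < v"
  shows "\<exists>J\<in>increasing_lists 0 (card (set xs)). \<exists>f. set f = {..<card (set xs)} \<and> xs = map ((!) J) f"
proof -
  define J where "J = sorted_list_of_set (set xs)"
  have J: "set J = set xs" "length J = card (set xs)" "distinct J" "sorted_wrt (<) J"
    by (simp_all add: J_def)
  have inc: "J \<in> increasing_lists 0 (card (set xs))"
    using J assms by (simp add: increasing_lists_def)
  define pos where "pos v = (THE i. i < length J \<and> J ! i = v)" for v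
  have pos: "pos v < length J \<and> J ! pos v = v" if "v \<in> set xs" for v
  proof -
    have "\<exists>!i. i < length J \<and> J ! i = v"
      using that J(1,3) by (metis in_set_conv_nth nth_eq_iff_index_eq)
    then show ?thesis unfolding pos_def by (rule theI')
  qed
  have "xs = map ((!) J) (map pos xs)" using pos by (simp add: map_idI)
  moreover have "set (map pos xs) = {..<card (set xs)}"
  proof (intro equalityI subsetI)
    fix i assume "i \<in> {..<card (set xs)}"
    then have i: "i < length J" using J(2) by simp
    then have v: "J ! i \<in> set xs" using J(1) nth_mem by blast
    then have "pos (J ! i) = i" using pos[OF v] i J(3) nth_eq_iff_index_eq by blast
    then show "i \<in> set (map pos xs)" using v by force
  qed (use pos J(2) in auto)
  ultimately show ?thesis using inc by blast
qed

lemma value_ordered_freqs_eq: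
  assumes "J \<in> increasing_lists 0 k" "set f = {..<k}" "observations X n \<omega> = map ((!) J) f"
  shows "value_ordered_freqs n (\<lambda>i. X i \<omega>) = pattern_counts f"
proof -
  note J = increasing_list_sorted[OF assms(1)]
  have img: "(\<lambda>i. X i \<omega>) ` {1..n} = set J"
    unfolding set_observations[symmetric] assms(3) by (rule set_map_nth) (simp add: assms(2) J(3))
  have cnt: "card {i\<in>{1..n}. X i \<omega> = v} = count_list (observations X n \<omega>) v" for v
  proof (induction n)
    case (Suc n)
    have "{i\<in>{1..Suc n}. X i \<omega> = v} = (if X (Suc n) \<omega> = v then {Suc n} else {}) \<union> {i\<in>{1..n}. X i \<omega> = v}"
      by (auto simp: le_Suc_eq)
    then show ?case using Suc by (simp add: observations_Suc)
  qed (simp add: observations_def)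
  have inj: "count_list (map ((!) J) f) (J ! r) = count_list f r" if "r < k" for r
  proof (rule count_list_inj_map)
    show "inj_on ((!) J) (set f)"
      using J assms(2) by (intro inj_on_nth) simp_all
    show "r \<in> set f" unfolding assms(2) using that by simp
  qed
  have "value_ordered_freqs n (\<lambda>i. X i \<omega>) = map (count_list (map ((!) J) f)) J"
    unfolding value_ordered_freqs_def img J(1) cnt assms(3) ..
  also have "\<dots> = map (\<lambda>r. count_list (map ((!) J) f) (J ! r)) [0..<k]"
    by (rule nth_equalityI) (simp_all add: J(3))
  also have "\<dots> = pattern_counts f"
    unfolding pattern_counts_def using inj by (simp add: assms(2))
  finally show ?thesis .
qed

lemma value_patterns_nonempty:
  assumes "\<forall>m\<in>set ns. 0 < m"
  shows "value_patterns ns \<noteq> {}"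
proof -
  define f where "f = concat (map (\<lambda>r. replicate (ns ! r) r) [0..<length ns])"
  have count: "count_list f r = ns ! r" if "r < length ns" for r
  proof -
    have "count_list (concat (map (\<lambda>r. replicate (ns ! r) r) rs)) r = (if r \<in> set rs then ns ! r else 0)"
      if "distinct rs" for rs
      using that
    proof (induction rs)
      case (Cons a rs)
      have "count_list (replicate m a) r = (if a = r then m else 0)" for m
        by (induction m) auto
      then show ?case using Cons by auto
    qed simp
    then show ?thesis using that by (simp add: f_def)
  qed
  have setf: "set f = {..<length ns}"
    using assms by (auto simp: f_def split: if_splits)
  have "pattern_counts f = ns"
    by (rule nth_equalityI) (use count in \<open>simp_all add: pattern_counts_def setf\<close>)
  then have "f \<in> value_patterns ns" using setf by (simp add: value_patterns_def)
  then show ?thesis by blast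
qed

lemma finite_value_patterns: "finite (value_patterns ns)"
proof (rule finite_subset)
  show "value_patterns ns \<subseteq> {f. set f \<subseteq> {..<length ns} \<and> length f = sum_list ns}"
  proof
    fix f assume f: "f \<in> value_patterns ns"
    show "f \<in> {f. set f \<subseteq> {..<length ns} \<and> length f = sum_list ns}"
      using value_patternsD(1,4)[OF f] by simp
  qed
  show "finite {f. set f \<subseteq> {..<length ns} \<and> length f = sum_list ns}"
    by (rule finite_lists_length_eq) simp
qed

lemma value_patterns_snoc:
  assumes "f \<in> value_patterns ns" "r < length ns"
  shows "f @ [r] \<in> value_patterns (ns[r := Suc (ns ! r)])"
proof -
  note f = value_patternsD[OF assms(1)]
  have s: "set (f @ [r]) = {..<length ns}" using f(1) assms(2) by auto
  then have "pattern_counts (f @ [r]) = ns[r := Suc (ns ! r)]"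
    using f(3) assms(2) unfolding pattern_counts_def s
    by (intro nth_equalityI) (auto simp: nth_list_update)
  then show ?thesis using s by (simp add: value_patterns_def)
qed

lemma finite_compositions: "finite {ns. is_composition n ns}"
proof (rule finite_subset)
  show "{ns. is_composition n ns} \<subseteq> {ns. set ns \<subseteq> {..n} \<and> length ns \<le> n}"
    using sum_list_ge_length member_le_sum_list by (fastforce simp: is_composition_def)
  show "finite {ns. set ns \<subseteq> {..n} \<and> length ns \<le> n}"
    by (rule finite_lists_length_le) simp
qed

section \<open>The event of a new value\<close>

locale gibbs_sample = gibbs_frequencies M \<alpha> V Y Q
  for M :: "'a measure" and \<alpha> V Y Q +
  fixes X :: "nat \<Rightarrow> 'a \<Rightarrow> nat"
  assumes observations_measurable [measurable]: "observations X n \<in> measurable M (count_space UNIV)"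
    and X_pos: "\<omega> \<in> space M \<Longrightarrow> 1 \<le> i \<Longrightarrow> 0 < X i \<omega>"
    and observations_prob: "xs \<noteq> [] \<Longrightarrow> \<forall>v\<in>set xs. 0 < v \<Longrightarrow>
      prob {\<omega>\<in>space M. observations X (length xs) \<omega> = xs} = expectation (Q_prod (mset xs))"
begin

definition pattern_event :: "nat list \<Rightarrow> 'a set" where
  "pattern_event f = {\<omega>\<in>space M. \<exists>J\<in>increasing_lists 0 (card (set f)).
      observations X (length f) \<omega> = map ((!) J) f}"

lemma observations_event: "{\<omega>\<in>space M. H (observations X n \<omega>)} \<in> sets M"
proof -
  have "observations X n -` {xs. H xs} \<inter> space M \<in> sets M"
    by (rule measurable_sets[OF observations_measurable]) simp
  moreover have "observations X n -` {xs. H xs} \<inter> space M = {\<omega>\<in>space M. H (observations X n \<omega>)}"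
    by auto
  ultimately show ?thesis by simp
qed

lemma pattern_event_sets [measurable]: "pattern_event f \<in> sets M"
  unfolding pattern_event_def by (rule observations_event)

text \<open>Given the frequencies, the pattern event is the disjoint union over the increasing lists \<open>J\<close> of values,
  and the sample equals \<open>map ((!) J) f\<close> with probability \<open>freq_monomial\<close>, which depends on \<open>f\<close> through its
  counts only.\<close>

lemma prob_pattern_event:
  assumes f: "f \<in> value_patterns ns" and ns: "ns \<noteq> []"
  shows "prob (pattern_event f) = V (length ns) (sum_list ns) * order_coeff \<alpha> ns"
proof -
  note vp = value_patternsD[OF f]
  define I where "I = increasing_lists 0 (length ns)"
  define Ev where "Ev J = {\<omega>\<in>space M. observations X (length f) \<omega> = map ((!) J) f}" for J
  have f_ne: "f \<noteq> []"
  proof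
    assume "f = []"
    then show False using vp(2) ns by simp
  qed
  have Ev_sets: "Ev J \<in> sets M" for J unfolding Ev_def by (rule observations_event)
  have disj: "disjoint_family_on Ev I"
    unfolding disjoint_family_on_def
  proof (intro ballI impI)
    fix J J' assume J: "J \<in> I" "J' \<in> I" "J \<noteq> J'"
    then have "map ((!) J) f \<noteq> map ((!) J') f"
      using value_pattern_unique(1)[of J "length ns" J' "length ns" f f] vp(1) unfolding I_def by blast
    then show "Ev J \<inter> Ev J' = {}" unfolding Ev_def by auto
  qed
  have ev: "emeasure M (Ev J) = (\<integral>\<^sup>+\<omega>. ennreal (freq_monomial (\<lambda>j. Q j \<omega>) ns J) \<partial>M)" if J: "J \<in> I" for J
  proof -
    have len: "length J = length ns" and pos: "\<forall>v\<in>set J. 0 < v"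
      using J by (auto simp: I_def increasing_lists_def)
    have "set (map ((!) J) f) = set J" by (rule set_map_nth) (simp add: vp(1) len)
    then have "prob (Ev J) = expectation (Q_prod (mset (map ((!) J) f)))"
      using observations_prob[of "map ((!) J) f"] pos f_ne by (simp only: Ev_def length_map map_is_Nil_conv simp_thms)
    moreover have "Q_prod (mset (map ((!) J) f)) \<omega> = freq_monomial (\<lambda>j. Q j \<omega>) ns J" for \<omega>
    proof -
      have "Q_prod (mset (map ((!) J) f)) \<omega> = prod_list (map (\<lambda>r. Q (J ! r) \<omega>) f)"
        unfolding Q_prod_def by (simp flip: mset_map add: prod_mset_prod_list comp_def)
      also have "\<dots> = (\<Prod>r<length ns. Q (J ! r) \<omega> ^ count_list f r)"
        by (rule prod_list_map_count) (simp add: vp(1))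
      also have "\<dots> = freq_monomial (\<lambda>j. Q j \<omega>) ns J"
        unfolding freq_monomial_def by (rule prod.cong) (simp_all add: vp(3))
      finally show ?thesis .
    qed
    moreover have "integrable M (Q_prod W)" for W
      using Q_prod_bounds[of W] by (intro integrable_const_bound[of _ 1]) auto
    ultimately show ?thesis
      using Q_prod_bounds(1)[of "mset (map ((!) J) f)"]
      by (simp add: emeasure_eq_measure nn_integral_eq_integral[symmetric])
  qed
  have meas: "(\<lambda>\<omega>. ennreal (freq_monomial (\<lambda>j. Q j \<omega>) ns J)) \<in> borel_measurable M" for J
    unfolding freq_monomial_def by measurable
  have "pattern_event f = (\<Union>J\<in>I. Ev J)"
    unfolding pattern_event_def Ev_def I_def vp(2) by blast
  then have "emeasure M (pattern_event f) = (\<integral>\<^sup>+J. emeasure M (Ev J) \<partial>count_space I)"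
    using emeasure_UN_countable[OF Ev_sets _ disj] countableI_type by simp
  also have "\<dots> = (\<integral>\<^sup>+J. \<integral>\<^sup>+\<omega>. ennreal (freq_monomial (\<lambda>j. Q j \<omega>) ns J) \<partial>M \<partial>count_space I)"
    by (rule nn_integral_cong) (simp add: ev)
  also have "\<dots> = (\<integral>\<^sup>+\<omega>. \<integral>\<^sup>+J. ennreal (freq_monomial (\<lambda>j. Q j \<omega>) ns J) \<partial>count_space I \<partial>M)"
    by (rule nn_integral_count_space_nn_integral[symmetric]) (simp_all only: countableI_type meas)
  also have "\<dots> = (\<integral>\<^sup>+\<omega>. ennreal (order_sum 0 ns \<omega>) \<partial>M)"
    unfolding I_def order_sum_def
    by (rule nn_integral_cong, rule nn_integral_freq_monomial[OF Q_nonneg Q_summable Q_sum_le vp(5)])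
  also have "\<dots> = ennreal (expectation (order_sum 0 ns))"
    using order_sum_bounds[OF vp(5), of 0]
    by (intro nn_integral_eq_integral integrable_const_bound[of _ 1]) auto
  finally have "prob (pattern_event f) = expectation (order_sum 0 ns)"
    using order_sum_bounds[OF vp(5), of 0]
    by (simp add: emeasure_eq_measure)
  then show ?thesis using expectation_order_sum[OF vp(5) ns] by simp
qed

lemma new_value_observations:
  "new_value n (\<lambda>i. X i \<omega>) \<longleftrightarrow> X (Suc n) \<omega> \<notin> set (observations X n \<omega>)"
  by (simp add: new_value_def set_observations)

lemma new_value_sets [measurable]: "{\<omega>\<in>space M. new_value n (\<lambda>i. X i \<omega>)} \<in> sets M"
proof -
  have "new_value n (\<lambda>i. X i \<omega>) \<longleftrightarrow>
      last (observations X (Suc n) \<omega>) \<notin> set (butlast (observations X (Suc n) \<omega>))" for \<omega>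
    by (simp add: new_value_observations observations_Suc)
  then show ?thesis by (simp only: observations_event[of "\<lambda>xs. last xs \<notin> set (butlast xs)"])
qed

lemma pattern_event_extend:
  assumes f: "f \<in> value_patterns ns"
  shows "pattern_event f - {\<omega>\<in>space M. new_value (length f) (\<lambda>i. X i \<omega>)}
    = (\<Union>r<length ns. pattern_event (f @ [r]))"
proof -
  note vp = value_patternsD[OF f]
  have pe: "\<omega> \<in> pattern_event (f @ [r]) \<longleftrightarrow> \<omega> \<in> space M \<and> (\<exists>J\<in>increasing_lists 0 (length ns).
      observations X (length f) \<omega> = map ((!) J) f \<and> X (Suc (length f)) \<omega> = J ! r)"
    if "r < length ns" for r \<omega>
  proof -
    have "set (f @ [r]) = set f" using vp(1) that by auto
    then have "card (set (f @ [r])) = length ns" using vp(2) by simp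
    then show ?thesis unfolding pattern_event_def by (simp add: observations_Suc)
  qed
  have set_obs: "set (observations X (length f) \<omega>) = (!) J ` {..<length ns}"
    if "observations X (length f) \<omega> = map ((!) J) f" for J \<omega>
    unfolding that set_map vp(1) ..
  show ?thesis
  proof (intro equalityI subsetI)
    fix \<omega> assume \<omega>: "\<omega> \<in> pattern_event f - {\<omega>\<in>space M. new_value (length f) (\<lambda>i. X i \<omega>)}"
    then obtain J where J: "J \<in> increasing_lists 0 (length ns)"
      "observations X (length f) \<omega> = map ((!) J) f" "\<omega> \<in> space M"
      unfolding pattern_event_def vp(2) by blast
    have "X (Suc (length f)) \<omega> \<in> (!) J ` {..<length ns}"
      using \<omega> J(3) unfolding new_value_observations set_obs[OF J(2), symmetric] by blast
    then obtain r where r: "X (Suc (length f)) \<omega> = J ! r" "r \<in> {..<length ns}" by (rule imageE)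
    then have "\<omega> \<in> pattern_event (f @ [r])" using pe[of r \<omega>] J by auto
    then show "\<omega> \<in> (\<Union>r<length ns. pattern_event (f @ [r]))" using r(2) by blast
  next
    fix \<omega> assume "\<omega> \<in> (\<Union>r<length ns. pattern_event (f @ [r]))"
    then obtain r where r: "r < length ns" "\<omega> \<in> pattern_event (f @ [r])" by blast
    then obtain J where J: "J \<in> increasing_lists 0 (length ns)" "\<omega> \<in> space M"
      "observations X (length f) \<omega> = map ((!) J) f" "X (Suc (length f)) \<omega> = J ! r"
      using pe[OF r(1)] by blast
    have "\<not> new_value (length f) (\<lambda>i. X i \<omega>)"
      unfolding new_value_observations set_obs[OF J(3)] J(4) using r(1) by blast
    moreover have "\<omega> \<in> pattern_event f" using J(1-3) unfolding pattern_event_def vp(2) by blast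
    ultimately show "\<omega> \<in> pattern_event f - {\<omega>\<in>space M. new_value (length f) (\<lambda>i. X i \<omega>)}" by blast
  qed
qed

lemma disjoint_pattern_events:
  assumes "\<And>i. i \<in> S \<Longrightarrow> set (g i) = {..<k i}" "\<And>i. i \<in> S \<Longrightarrow> length (g i) = n" "inj_on g S"
  shows "disjoint_family_on (\<lambda>i. pattern_event (g i)) S"
  unfolding disjoint_family_on_def
proof (intro ballI impI)
  fix i j assume ij: "i \<in> S" "j \<in> S" "i \<noteq> j"
  have "g i \<noteq> g j" using ij assms(3) by (auto dest: inj_onD)
  moreover have "g i = g j" if "\<omega> \<in> pattern_event (g i)" "\<omega> \<in> pattern_event (g j)" for \<omega>
  proof -
    from that(1) obtain J where J: "J \<in> increasing_lists 0 (k i)" "observations X n \<omega> = map ((!) J) (g i)"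
      unfolding pattern_event_def assms(1,2)[OF ij(1)] card_lessThan by blast
    from that(2) obtain J' where J': "J' \<in> increasing_lists 0 (k j)" "observations X n \<omega> = map ((!) J') (g j)"
      unfolding pattern_event_def assms(1,2)[OF ij(2)] card_lessThan by blast
    show "g i = g j"
      by (rule value_pattern_unique(2)[OF J(1) J'(1) assms(1)[OF ij(1)] assms(1)[OF ij(2)]])
        (simp only: J(2)[symmetric] J'(2)[symmetric])
  qed
  ultimately show "pattern_event (g i) \<inter> pattern_event (g j) = {}" by blast
qed

text \<open>The continuations by an old value carry \<open>(n - k * \<alpha>) * V k (n + 1)\<close> times the coefficient of \<open>ns\<close>, and the
  Gibbs recursion splits \<open>V k n\<close> accordingly.\<close>

lemma prob_pattern_event_new:
  assumes f: "f \<in> value_patterns ns" and ns: "ns \<noteq> []"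
  shows "prob (pattern_event f \<inter> {\<omega>\<in>space M. new_value (length f) (\<lambda>i. X i \<omega>)}) =
    V (length ns + 1) (sum_list ns + 1) * order_coeff \<alpha> ns"
proof -
  note vp = value_patternsD[OF f]
  let ?N = "{\<omega>\<in>space M. new_value (length f) (\<lambda>i. X i \<omega>)}"
  have "prob (pattern_event f - ?N) = (\<Sum>r<length ns. prob (pattern_event (f @ [r])))"
    unfolding pattern_event_extend[OF f]
  proof (rule finite_measure_finite_Union)
    show "disjoint_family_on (\<lambda>r. pattern_event (f @ [r])) {..<length ns}"
      by (rule disjoint_pattern_events[where n="Suc (length f)" and k="\<lambda>_. length ns"])
        (use vp(1) in \<open>auto simp: inj_on_def\<close>)
  qed auto
  also have "\<dots> = (\<Sum>r<length ns. V (length ns) (sum_list ns + 1) * order_coeff \<alpha> (ns[r := Suc (ns ! r)]))"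
  proof (rule sum.cong[OF refl])
    fix r assume r: "r \<in> {..<length ns}"
    show "prob (pattern_event (f @ [r])) =
        V (length ns) (sum_list ns + 1) * order_coeff \<alpha> (ns[r := Suc (ns ! r)])"
      using prob_pattern_event[OF value_patterns_snoc[OF f, of r]] r ns sum_list_update_Suc[of r ns]
      by simp
  qed
  also have "\<dots> = V (length ns) (sum_list ns + 1) *
      ((real (sum_list ns) - real (length ns) * \<alpha>) * order_coeff \<alpha> ns)"
    unfolding sum_distrib_left[symmetric] sum_order_coeff_increment[OF vp(5) alpha] ..
  finally have old: "prob (pattern_event f - ?N) = \<dots>" .
  have "prob (pattern_event f) = prob (pattern_event f \<inter> ?N) + prob (pattern_event f - ?N)"
    using finite_measure_Diff'[of "pattern_event f" ?N] by simp
  then have "prob (pattern_event f \<inter> ?N) = V (length ns) (sum_list ns) * order_coeff \<alpha> ns -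
      V (length ns) (sum_list ns + 1) * ((real (sum_list ns) - real (length ns) * \<alpha>) * order_coeff \<alpha> ns)"
    unfolding prob_pattern_event[OF f ns] old by linarith
  also have "V (length ns) (sum_list ns) = (real (sum_list ns) - real (length ns) * \<alpha>) *
      V (length ns) (sum_list ns + 1) + V (length ns + 1) (sum_list ns + 1)"
    by (rule gibbs_weights_rec[OF weights _ sum_list_ge_length[OF vp(5)]])
      (use ns in \<open>simp add: Suc_le_eq\<close>)
  also have "(a * b + c) * d - b * (a * d) = c * d" for a b c d :: real
    by (simp add: algebra_simps)
  finally show ?thesis .
qed

lemma value_ordered_freqs_event:
  assumes "is_composition n ns"
  shows "{\<omega>\<in>space M. value_ordered_freqs n (\<lambda>i. X i \<omega>) = ns} = (\<Union>f\<in>value_patterns ns. pattern_event f)"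
proof (intro equalityI subsetI)
  fix \<omega> assume "\<omega> \<in> {\<omega>\<in>space M. value_ordered_freqs n (\<lambda>i. X i \<omega>) = ns}"
  then have \<omega>: "\<omega> \<in> space M" "value_ordered_freqs n (\<lambda>i. X i \<omega>) = ns" by auto
  have "\<forall>v\<in>set (observations X n \<omega>). 0 < v"
    unfolding set_observations using X_pos[OF \<omega>(1)] by auto
  from value_pattern_exists[OF this] obtain J f where
    J: "J \<in> increasing_lists 0 (card (set (observations X n \<omega>)))"
    and f: "set f = {..<card (set (observations X n \<omega>))}" "observations X n \<omega> = map ((!) J) f" by blast
  have "pattern_counts f = ns" using value_ordered_freqs_eq[OF J f] \<omega>(2) by simp
  moreover from this have "length ns = card (set f)" by (auto simp: pattern_counts_def)
  ultimately have fv: "f \<in> value_patterns ns" using f(1) by (simp add: value_patterns_def)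
  have len: "length f = n" using arg_cong[OF f(2), of length] by simp
  have card: "card (set f) = card (set (observations X n \<omega>))" unfolding f(1) by simp
  have "\<omega> \<in> pattern_event f"
    unfolding pattern_event_def len card using \<omega>(1) J f(2) by blast
  then show "\<omega> \<in> (\<Union>f\<in>value_patterns ns. pattern_event f)" using fv by blast
next
  fix \<omega> assume "\<omega> \<in> (\<Union>f\<in>value_patterns ns. pattern_event f)"
  then obtain f where f: "f \<in> value_patterns ns" "\<omega> \<in> pattern_event f" by blast
  note vp = value_patternsD[OF f(1)]
  have n: "length f = n" using vp(4) assms by (simp add: is_composition_def)
  from f(2) obtain J where J: "J \<in> increasing_lists 0 (length ns)" "\<omega> \<in> space M"
    "observations X n \<omega> = map ((!) J) f"
    unfolding pattern_event_def vp(2) n by blast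
  have "pattern_counts f = ns" using f(1) by (simp add: value_patterns_def)
  then show "\<omega> \<in> {\<omega>\<in>space M. value_ordered_freqs n (\<lambda>i. X i \<omega>) = ns}"
    using value_ordered_freqs_eq[OF J(1) vp(1) J(3)] J(2) by simp
qed

lemma value_ordered_freqs_composition:
  assumes "\<omega> \<in> space M"
  shows "is_composition n (value_ordered_freqs n (\<lambda>i. X i \<omega>))"
    and "length (value_ordered_freqs n (\<lambda>i. X i \<omega>)) = num_distinct n (\<lambda>i. X i \<omega>)"
proof -
  show "length (value_ordered_freqs n (\<lambda>i. X i \<omega>)) = num_distinct n (\<lambda>i. X i \<omega>)"
    by (simp add: value_ordered_freqs_def num_distinct_def)
  have "\<forall>v\<in>set (observations X n \<omega>). 0 < v"
    unfolding set_observations using X_pos[OF assms] by auto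
  from value_pattern_exists[OF this] obtain J f where
    J: "J \<in> increasing_lists 0 (card (set (observations X n \<omega>)))"
    and f: "set f = {..<card (set (observations X n \<omega>))}" "observations X n \<omega> = map ((!) J) f" by blast
  have v: "value_ordered_freqs n (\<lambda>i. X i \<omega>) = pattern_counts f" by (rule value_ordered_freqs_eq[OF J f])
  have "f \<in> value_patterns (pattern_counts f)" using f(1) by (simp add: value_patterns_def pattern_counts_def)
  note vp = value_patternsD[OF this]
  have "length f = n" using arg_cong[OF f(2), of length] by simp
  then show "is_composition n (value_ordered_freqs n (\<lambda>i. X i \<omega>))"
    using vp(4,5) unfolding v is_composition_def by simp
qed

lemma value_ordered_freqs_eq_sets:
  "is_composition n ns \<Longrightarrow> {\<omega>\<in>space M. value_ordered_freqs n (\<lambda>i. X i \<omega>) = ns} \<in> sets M"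
  unfolding value_ordered_freqs_event
  by (intro sets.finite_UN finite_value_patterns pattern_event_sets)

lemma prob_value_ordered_freqs:
  assumes ns: "is_composition n ns" and n: "1 \<le> n"
  shows "prob {\<omega>\<in>space M. value_ordered_freqs n (\<lambda>i. X i \<omega>) = ns} =
      real (card (value_patterns ns)) * (V (length ns) n * order_coeff \<alpha> ns)" (is ?A)
    and "prob {\<omega>\<in>space M. new_value n (\<lambda>i. X i \<omega>) \<and> value_ordered_freqs n (\<lambda>i. X i \<omega>) = ns} =
      real (card (value_patterns ns)) * (V (length ns + 1) (n + 1) * order_coeff \<alpha> ns)" (is ?B)
proof -
  have pos: "\<forall>m\<in>set ns. 0 < m" "sum_list ns = n" using ns by (auto simp: is_composition_def)
  have ne: "ns \<noteq> []" using pos(2) n by auto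
  let ?N = "{\<omega>\<in>space M. new_value n (\<lambda>i. X i \<omega>)}"
  have disj: "disjoint_family_on pattern_event (value_patterns ns)"
    by (rule disjoint_pattern_events[of "value_patterns ns" "\<lambda>f. f" "\<lambda>_. length ns" n])
      (use value_patternsD(1,4) pos(2) in auto)
  have "prob (\<Union>f\<in>value_patterns ns. pattern_event f) = (\<Sum>f\<in>value_patterns ns. prob (pattern_event f))"
    by (rule finite_measure_finite_Union[OF finite_value_patterns _ disj]) auto
  also have "\<dots> = (\<Sum>f\<in>value_patterns ns. V (length ns) n * order_coeff \<alpha> ns)"
    by (rule sum.cong) (use prob_pattern_event[OF _ ne] pos(2) in auto)
  finally show ?A unfolding value_ordered_freqs_event[OF ns] by simp
  have "{\<omega>\<in>space M. new_value n (\<lambda>i. X i \<omega>) \<and> value_ordered_freqs n (\<lambda>i. X i \<omega>) = ns}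
      = (\<Union>f\<in>value_patterns ns. pattern_event f \<inter> ?N)"
    using value_ordered_freqs_event[OF ns] by auto
  also have "prob \<dots> = (\<Sum>f\<in>value_patterns ns. prob (pattern_event f \<inter> ?N))"
  proof (rule finite_measure_finite_Union[OF finite_value_patterns])
    show "disjoint_family_on (\<lambda>f. pattern_event f \<inter> ?N) (value_patterns ns)"
      using disj unfolding disjoint_family_on_def by blast
  qed auto
  also have "\<dots> = (\<Sum>f\<in>value_patterns ns. V (length ns + 1) (n + 1) * order_coeff \<alpha> ns)"
  proof (rule sum.cong[OF refl])
    fix f assume f: "f \<in> value_patterns ns"
    have "length f = n" using value_patternsD(4)[OF f] pos(2) by simp
    then show "prob (pattern_event f \<inter> ?N) = V (length ns + 1) (n + 1) * order_coeff \<alpha> ns"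
      using prob_pattern_event_new[OF f ne] pos(2) by simp
  qed
  finally show ?B by simp
qed

definition new_value_prob :: "nat \<Rightarrow> nat \<Rightarrow> real" where
  "new_value_prob n k = V (k + 1) (n + 1) / V k n"

lemma prob_new_value_and_freqs:
  assumes ns: "is_composition n ns" and n: "1 \<le> n"
  shows "prob {\<omega>\<in>space M. new_value n (\<lambda>i. X i \<omega>) \<and> value_ordered_freqs n (\<lambda>i. X i \<omega>) = ns} =
      new_value_prob n (length ns) * prob {\<omega>\<in>space M. value_ordered_freqs n (\<lambda>i. X i \<omega>) = ns}"
    and "0 < prob {\<omega>\<in>space M. value_ordered_freqs n (\<lambda>i. X i \<omega>) = ns}"
proof -
  have pos: "\<forall>m\<in>set ns. 0 < m" "sum_list ns = n" using ns by (auto simp: is_composition_def)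
  have "ns \<noteq> []" using pos(2) n by auto
  then have V: "0 < V (length ns) n"
    using weights sum_list_ge_length[OF pos(1)] pos(2) unfolding gibbs_weights_def
    by (metis One_nat_def Suc_leI length_greater_0_conv)
  then show "prob {\<omega>\<in>space M. new_value n (\<lambda>i. X i \<omega>) \<and> value_ordered_freqs n (\<lambda>i. X i \<omega>) = ns} =
      new_value_prob n (length ns) * prob {\<omega>\<in>space M. value_ordered_freqs n (\<lambda>i. X i \<omega>) = ns}"
    unfolding prob_value_ordered_freqs[OF assms] new_value_prob_def by simp
  have "0 < card (value_patterns ns)"
    using value_patterns_nonempty[OF pos(1)] finite_value_patterns by (simp add: card_gt_0_iff)
  then show "0 < prob {\<omega>\<in>space M. value_ordered_freqs n (\<lambda>i. X i \<omega>) = ns}"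
    unfolding prob_value_ordered_freqs[OF assms] using V order_coeff_pos[OF pos(1) alpha] by simp
qed

lemma value_ordered_freqs_sets:
  "{\<omega>\<in>space M. value_ordered_freqs n (\<lambda>i. X i \<omega>) \<in> B} \<in> sets M"
proof -
  have "{\<omega>\<in>space M. value_ordered_freqs n (\<lambda>i. X i \<omega>) \<in> B} =
      (\<Union>ns\<in>{ns. is_composition n ns} \<inter> B. {\<omega>\<in>space M. value_ordered_freqs n (\<lambda>i. X i \<omega>) = ns})"
    using value_ordered_freqs_composition(1) by blast
  also have "\<dots> \<in> sets M"
    by (intro sets.finite_UN finite_Int value_ordered_freqs_eq_sets) (auto simp: finite_compositions)
  finally show ?thesis .
qed

lemma prob_new_value_and_freqs_in:
  assumes n: "1 \<le> n" and B: "\<And>ns. ns \<in> B \<Longrightarrow> length ns = k"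
  shows "prob {\<omega>\<in>space M. new_value n (\<lambda>i. X i \<omega>) \<and> value_ordered_freqs n (\<lambda>i. X i \<omega>) \<in> B} =
    new_value_prob n k * prob {\<omega>\<in>space M. value_ordered_freqs n (\<lambda>i. X i \<omega>) \<in> B}"
proof -
  let ?S = "{ns. is_composition n ns} \<inter> B"
  let ?E = "\<lambda>ns. {\<omega>\<in>space M. value_ordered_freqs n (\<lambda>i. X i \<omega>) = ns}"
  let ?N = "{\<omega>\<in>space M. new_value n (\<lambda>i. X i \<omega>)}"
  have fin: "finite ?S" using finite_compositions by blast
  have E: "?E ns \<in> sets M" if "ns \<in> ?S" for ns using that value_ordered_freqs_eq_sets by simp
  have "{\<omega>\<in>space M. value_ordered_freqs n (\<lambda>i. X i \<omega>) \<in> B} = (\<Union>ns\<in>?S. ?E ns)"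
    using value_ordered_freqs_composition(1) by blast
  also have "prob \<dots> = (\<Sum>ns\<in>?S. prob (?E ns))"
    by (rule finite_measure_finite_Union[OF fin]) (use E in \<open>auto simp: disjoint_family_on_def\<close>)
  finally have all: "prob {\<omega>\<in>space M. value_ordered_freqs n (\<lambda>i. X i \<omega>) \<in> B} = (\<Sum>ns\<in>?S. prob (?E ns))" .
  have "{\<omega>\<in>space M. new_value n (\<lambda>i. X i \<omega>) \<and> value_ordered_freqs n (\<lambda>i. X i \<omega>) \<in> B}
      = (\<Union>ns\<in>?S. ?N \<inter> ?E ns)"
    using value_ordered_freqs_composition(1) by blast
  also have "prob \<dots> = (\<Sum>ns\<in>?S. prob (?N \<inter> ?E ns))"
    by (rule finite_measure_finite_Union[OF fin]) (use E in \<open>auto simp: disjoint_family_on_def\<close>)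
  also have "\<dots> = (\<Sum>ns\<in>?S. new_value_prob n k * prob (?E ns))"
  proof (rule sum.cong[OF refl])
    fix ns assume ns: "ns \<in> ?S"
    have "?N \<inter> ?E ns = {\<omega>\<in>space M. new_value n (\<lambda>i. X i \<omega>) \<and> value_ordered_freqs n (\<lambda>i. X i \<omega>) = ns}"
      by blast
    then show "prob (?N \<inter> ?E ns) = new_value_prob n k * prob (?E ns)"
      using prob_new_value_and_freqs(1)[OF _ n, of ns] ns B[of ns] by simp
  qed
  finally show ?thesis unfolding all sum_distrib_left .
qed

text \<open>Given \<open>k\<close> distinct values, the conditional probability of a new value is the constant
  \<open>new_value_prob n k\<close> on each set of value-ordered frequencies; a constant conditional probability is
  independence.\<close>

lemma new_value_indep_freqs:
  assumes n: "1 \<le> n" and Ck: "0 < prob {\<omega>\<in>space M. num_distinct n (\<lambda>i. X i \<omega>) = k}"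
  shows "prob_space.indep_set
    (uniform_measure M {\<omega>\<in>space M. num_distinct n (\<lambda>i. X i \<omega>) = k})
    {{\<omega>\<in>space M. new_value n (\<lambda>i. X i \<omega>)}}
    (range (\<lambda>B. {\<omega>\<in>space M. value_ordered_freqs n (\<lambda>i. X i \<omega>) \<in> B}))"
proof -
  let ?C = "{\<omega>\<in>space M. num_distinct n (\<lambda>i. X i \<omega>) = k}"
  let ?D = "uniform_measure M ?C"
  let ?N = "{\<omega>\<in>space M. new_value n (\<lambda>i. X i \<omega>)}"
  let ?E = "\<lambda>B. {\<omega>\<in>space M. value_ordered_freqs n (\<lambda>i. X i \<omega>) \<in> B}"
  let ?L = "{ns. length ns = k}"
  have C_eq: "?C = ?E ?L" using value_ordered_freqs_composition(2) by auto
  have C: "?C \<in> sets M" unfolding C_eq by (rule value_ordered_freqs_sets)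
  have C0: "emeasure M ?C \<noteq> 0" using Ck by (simp add: emeasure_eq_measure)
  interpret D: prob_space ?D
    by (rule prob_space_uniform_measure) (use C0 in \<open>auto simp: emeasure_eq_measure\<close>)
  have D: "measure ?D A = prob (?C \<inter> A) / prob ?C" if "A \<in> sets M" for A
    using C0 that by (intro measure_uniform_measure) (auto simp: emeasure_eq_measure)
  have E: "prob (?C \<inter> ?E B) = prob (?E (B \<inter> ?L))" for B
    unfolding C_eq by (rule arg_cong[where f=prob]) blast
  have NE: "prob (?C \<inter> (?N \<inter> ?E B)) = new_value_prob n k * prob (?E (B \<inter> ?L))" for B
  proof -
    have "?C \<inter> (?N \<inter> ?E B) = {\<omega>\<in>space M. new_value n (\<lambda>i. X i \<omega>)
        \<and> value_ordered_freqs n (\<lambda>i. X i \<omega>) \<in> B \<inter> ?L}"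
      unfolding C_eq by blast
    then show ?thesis using prob_new_value_and_freqs_in[OF n, of "B \<inter> ?L" k] by simp
  qed
  have N: "prob (?C \<inter> ?N) = new_value_prob n k * prob ?C"
  proof -
    have "?C \<inter> ?N = ?C \<inter> (?N \<inter> ?E UNIV)" by blast
    then show ?thesis using NE[of UNIV] C_eq by simp
  qed
  show ?thesis
    unfolding D.indep_sets2_eq
  proof (intro conjI ballI)
    show "{?N} \<subseteq> D.events" by simp
    show "range ?E \<subseteq> D.events" using value_ordered_freqs_sets by auto
    fix A A' assume "A \<in> {?N}" "A' \<in> range ?E"
    then obtain B where A: "A = ?N" "A' = ?E B" by blast
    have "D.prob (?N \<inter> ?E B) = prob (?C \<inter> (?N \<inter> ?E B)) / prob ?C"
      by (rule D) (intro sets.Int new_value_sets value_ordered_freqs_sets)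
    also have "\<dots> = new_value_prob n k * (prob (?C \<inter> ?E B) / prob ?C)"
      unfolding NE E by simp
    also have "\<dots> = D.prob ?N * D.prob (?E B)"
      unfolding D[OF new_value_sets] D[OF value_ordered_freqs_sets] N using Ck by simp
    finally show "D.prob (A \<inter> A') = D.prob A * D.prob A'" unfolding A .
  qed
qed

end

lemma gibbs_sample_exists:
  fixes M :: "'a measure"
  assumes "prob_space M" "0 \<le> \<alpha>" "\<alpha> < 1" "gibbs_partition M \<alpha> R"
    and freq: "size_biased_limit_frequencies M R P"
    and "AE \<omega> in M. \<forall>j\<ge>1. 0 < P j \<omega>"
    and "AE \<omega> in M. ((\<lambda>j. P j \<omega>) has_sum 1) {1..}"
    and sample: "random_sample M P X"
  shows "\<exists>V Y Q. gibbs_sample M \<alpha> V Y Q X"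
proof -
  from gibbs_frequencies_exist[OF assms(1-7)] obtain V Y Q where
    gf: "gibbs_frequencies M \<alpha> V Y Q" and QP: "AE \<omega> in M. \<forall>j\<ge>1. Q j \<omega> = P j \<omega>" by blast
  interpret gibbs_frequencies M \<alpha> V Y Q by fact
  have P: "P j \<in> borel_measurable M" if "1 \<le> j" for j
    using freq that unfolding size_biased_limit_frequencies_def by blast
  have X: "X i \<in> measurable M (count_space {1..})" if "1 \<le> i" for i
    using sample that unfolding random_sample_def cond_indep_vars_def by simp
  have nth_obs: "observations X n \<omega> ! i = X (Suc i) \<omega>" if "i < n" for i n \<omega>
    using that by (simp add: observations_def del: upt_Suc)
  have obs_iff: "observations X (length xs) \<omega> = xs \<longleftrightarrow> (\<forall>i\<in>{1..length xs}. X i \<omega> = xs ! (i - 1))" for xs \<omega>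
  proof
    assume obs: "observations X (length xs) \<omega> = xs"
    show "\<forall>i\<in>{1..length xs}. X i \<omega> = xs ! (i - 1)"
    proof
      fix i assume "i \<in> {1..length xs}"
      then have "i - 1 < length xs" "Suc (i - 1) = i" by auto
      then show "X i \<omega> = xs ! (i - 1)" using nth_obs[of "i - 1" "length xs" \<omega>] obs by simp
    qed
  next
    assume "\<forall>i\<in>{1..length xs}. X i \<omega> = xs ! (i - 1)"
    then show "observations X (length xs) \<omega> = xs"
      by (intro nth_equalityI) (auto simp: nth_obs)
  qed
  have X_event: "{\<omega>\<in>space M. X i \<omega> = v} \<in> sets M" if "1 \<le> i" for i v
  proof -
    have "X i -` ({v} \<inter> {1..}) \<inter> space M \<in> sets M"
      by (rule measurable_sets[OF X[OF that]]) simp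
    moreover have "X i -` ({v} \<inter> {1..}) \<inter> space M = {\<omega>\<in>space M. X i \<omega> = v}"
      using measurable_space[OF X[OF that]] by auto
    ultimately show ?thesis by simp
  qed
  have event: "{\<omega>\<in>space M. \<forall>i\<in>{1..n}. X i \<omega> = x i} \<in> sets M" for n x
    by (rule sets.sets_Collect_finite_All) (use X_event in auto)
  have "gibbs_sample M \<alpha> V Y Q X"
  proof
    show "observations X n \<in> measurable M (count_space UNIV)" for n
      unfolding measurable_count_space_eq2_countable
    proof (intro conjI ballI)
      fix xs :: "nat list"
      have "{\<omega>\<in>space M. observations X n \<omega> = xs} \<in> sets M"
      proof (cases "length xs = n")
        case True
        then show ?thesis using event[of n "\<lambda>i. xs ! (i - 1)"] obs_iff[of xs] by simp
      next
        case False
        then have "{\<omega>\<in>space M. observations X n \<omega> = xs} = {}" by (auto dest: arg_cong[of _ _ length])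
        then show ?thesis by (metis sets.empty_sets)
      qed
      moreover have "observations X n -` {xs} \<inter> space M = {\<omega>\<in>space M. observations X n \<omega> = xs}" by auto
      ultimately show "observations X n -` {xs} \<inter> space M \<in> sets M" by simp
    qed simp
    show "0 < X i \<omega>" if "\<omega> \<in> space M" "1 \<le> i" for \<omega> i
      using measurable_space[OF X[OF that(2)] that(1)] by simp
    show "prob {\<omega>\<in>space M. observations X (length xs) \<omega> = xs} = expectation (Q_prod (mset xs))"
      if xs: "xs \<noteq> []" "\<forall>v\<in>set xs. 0 < v" for xs
    proof -
      define x where "x i = xs ! (i - 1)" for i
      have x: "1 \<le> x i" if "i \<in> {1..length xs}" for i
        using xs(2) that by (auto simp: x_def Suc_le_eq)
      have "prob {\<omega>\<in>space M. observations X (length xs) \<omega> = xs} =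
          expectation (\<lambda>\<omega>. \<Prod>i\<in>{1..length xs}. P (x i) \<omega>)"
        unfolding obs_iff x_def[symmetric]
        by (rule sample_prob[OF assms(1) P sample x _ event]) (use xs(1) in \<open>simp_all add: Suc_le_eq\<close>)
      also have "\<dots> = expectation (Q_prod (mset xs))"
      proof (rule integral_cong_AE)
        show "(\<lambda>\<omega>. \<Prod>i\<in>{1..length xs}. P (x i) \<omega>) \<in> borel_measurable M"
          by (intro borel_measurable_prod P x)
        show "AE \<omega> in M. (\<Prod>i\<in>{1..length xs}. P (x i) \<omega>) = Q_prod (mset xs) \<omega>"
          using QP
        proof eventually_elim
          case (elim \<omega>)
          have "Q_prod (mset xs) \<omega> = prod_list (map (\<lambda>j. Q j \<omega>) xs)"
            unfolding Q_prod_def by (simp flip: mset_map add: prod_mset_prod_list)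
          also have "\<dots> = (\<Prod>i\<in>{0..<length xs}. Q (xs ! i) \<omega>)"
            unfolding prod.list_conv_set_nth by simp
          also have "\<dots> = (\<Prod>i\<in>{1..length xs}. Q (x i) \<omega>)"
            by (rule prod.reindex_bij_witness[of _ "\<lambda>i. i - 1" Suc]) (auto simp: x_def)
          also have "\<dots> = (\<Prod>i\<in>{1..length xs}. P (x i) \<omega>)"
            by (rule prod.cong[OF refl]) (use elim x in blast)
          finally show ?case by simp
        qed
      qed simp
      finally show ?thesis .
    qed
  qed
  then show ?thesis by blast
qed

theorem corollary1p3:
  fixes M :: "'a measure" and \<alpha> :: real
    and R :: "nat \<Rightarrow> 'a \<Rightarrow> nat set set"
    and P :: "nat \<Rightarrow> 'a \<Rightarrow> real"
    and X :: "nat \<Rightarrow> 'a \<Rightarrow> nat"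
    and n :: nat
  assumes "prob_space M"
    and "0 \<le> \<alpha>" and "\<alpha> < 1"
    and "gibbs_partition M \<alpha> R"
    and "size_biased_limit_frequencies M R P"
    and "AE \<omega> in M. \<forall>j\<ge>1. 0 < P j \<omega>"
    and "AE \<omega> in M. ((\<lambda>j. P j \<omega>) has_sum 1) {1..}"
    and "random_sample M P X"
    and "1 \<le> n"
  shows "(\<forall>k. 0 < measure M {\<omega>\<in>space M. num_distinct n (\<lambda>i. X i \<omega>) = k} \<longrightarrow>
            prob_space.indep_set
              (uniform_measure M {\<omega>\<in>space M. num_distinct n (\<lambda>i. X i \<omega>) = k})
              {{\<omega>\<in>space M. new_value n (\<lambda>i. X i \<omega>)}}
              (range (\<lambda>B. {\<omega>\<in>space M. value_ordered_freqs n (\<lambda>i. X i \<omega>) \<in> B})))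
       \<and> (\<exists>q :: nat \<Rightarrow> real. \<forall>ns. is_composition n ns \<longrightarrow>
            cond_prob M (\<lambda>\<omega>. new_value n (\<lambda>i. X i \<omega>))
              (\<lambda>\<omega>. value_ordered_freqs n (\<lambda>i. X i \<omega>) = ns) = q (length ns))"
proof -
  from gibbs_sample_exists[OF assms(1-8)] obtain V Y Q where "gibbs_sample M \<alpha> V Y Q X" by blast
  then interpret gibbs_sample M \<alpha> V Y Q X .
  have "cond_prob M (\<lambda>\<omega>. new_value n (\<lambda>i. X i \<omega>)) (\<lambda>\<omega>. value_ordered_freqs n (\<lambda>i. X i \<omega>) = ns)
      = new_value_prob n (length ns)" if "is_composition n ns" for ns
    using prob_new_value_and_freqs[OF that \<open>1 \<le> n\<close>] by (simp add: cond_prob_def)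
  then show ?thesis using new_value_indep_freqs[OF \<open>1 \<le> n\<close>] by blast
qed

end
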